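(* Let $n\ge 1$ and $0\le i,j,k\le n$. The number of permutations $\sigma\in S_n$ avoiding the pattern $321$ with $\mathrm{fp}(\sigma)=i$, $\mathrm{exc}(\sigma)=j$ and $\ell(\sigma)=k$ equals the number of permutations $\sigma\in S_n$ avoiding the pattern $132$ with $\mathrm{fp}(\sigma)=i$, $\mathrm{exc}(\sigma)=j$ and $\mathrm{rk}(\sigma)=n-k$.
   Context: A permutation $\sigma\in S_n$ contains $\pi\in S_m$ if there are indices $i_1<\dots<i_m$ with $(\sigma(i_1),\dots,\sigma(i_m))$ in the same relative order as $(\pi(1),\dots,\pi(m))$; otherwise $\sigma$ avoids $\pi$. $\mathrm{fp}(\sigma)$ is the number of $i$ with $\sigma(i)=i$ (fixed points); $\mathrm{exc}(\sigma)$ is the number of $i$ with $\sigma(i)>i$ (excedances). $\ell(\sigma)$ is the length of the longest increasing subsequence of $\sigma$. The rank $\mathrm{rk}(\sigma)$ is the largest $k\ge 0$ such that $\sigma(i)>k$ for all $i\le k$. *)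

theory Defs
  imports "HOL-Combinatorics.Permutations"
begin

text \<open>
  The symmetric group \<open>S\<^sub>n\<close> is rendered as the set of all \<open>\<sigma> :: nat \<Rightarrow> nat\<close> with
  \<open>\<sigma> permutes {1..n}\<close>. Such a \<open>\<sigma>\<close> is the identity outside \<open>{1..n}\<close>, so statistics
  take \<open>n\<close> as an explicit argument and only range over positions in \<open>{1..n}\<close>.
\<close>

text \<open>The permutation with one-line notation \<open>xs\<close>; positions and values start at 1.\<close>

definition one_line :: "nat list \<Rightarrow> nat \<Rightarrow> nat" where
  "one_line xs i = (if i \<in> {1..length xs} then xs ! (i - 1) else i)"

definition contains_pattern :: "nat \<Rightarrow> (nat \<Rightarrow> nat) \<Rightarrow> nat \<Rightarrow> (nat \<Rightarrow> nat) \<Rightarrow> bool" where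
  "contains_pattern n \<sigma> m \<pi> \<longleftrightarrow>
     (\<exists>p. strict_mono_on {1..m} p \<and> p ` {1..m} \<subseteq> {1..n} \<and>
          (\<forall>a\<in>{1..m}. \<forall>b\<in>{1..m}. \<sigma> (p a) < \<sigma> (p b) \<longleftrightarrow> \<pi> a < \<pi> b))"

definition avoiders :: "nat \<Rightarrow> nat list \<Rightarrow> (nat \<Rightarrow> nat) set" where
  "avoiders n xs =
     {\<sigma>. \<sigma> permutes {1..n} \<and> \<not> contains_pattern n \<sigma> (length xs) (one_line xs)}"

definition fp :: "nat \<Rightarrow> (nat \<Rightarrow> nat) \<Rightarrow> nat" where
  "fp n \<sigma> = card {i \<in> {1..n}. \<sigma> i = i}"

definition exc :: "nat \<Rightarrow> (nat \<Rightarrow> nat) \<Rightarrow> nat" where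
  "exc n \<sigma> = card {i \<in> {1..n}. \<sigma> i > i}"

text \<open>An increasing subsequence is identified with its set of positions.\<close>

definition lis :: "nat \<Rightarrow> (nat \<Rightarrow> nat) \<Rightarrow> nat" where
  "lis n \<sigma> = Max {card S | S. S \<subseteq> {1..n} \<and> strict_mono_on S \<sigma>}"

text \<open>
  The bound \<open>k \<le> n\<close> excludes nothing when \<open>\<sigma> permutes {1..n}\<close>: for \<open>k > n\<close> the condition
  already fails at \<open>i = k\<close>, where \<open>\<sigma> k = k\<close>. It only makes the set visibly finite.
\<close>

definition rk :: "nat \<Rightarrow> (nat \<Rightarrow> nat) \<Rightarrow> nat" where
  "rk n \<sigma> = Max {k. k \<le> n \<and> (\<forall>i\<in>{1..k}. \<sigma> i > k)}"

end

(*
  Both sides are encoded by words of n pairs of bits, and the words are matched letter by letter.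

  A 321-avoiding permutation increases on its excedances and on the remaining positions, so it is
  determined by the set P of its excedance positions and the set Q of its excedance values. Reading
  t = 1, ..., n, let h be the number of positions <= t with value > t, and let alpha and beta be the
  lengths of the longest increasing subsequences among the positions <= t and among the values <= t.
  Then (h + alpha - beta, h + beta - alpha) evolves as a deterministic function of the letters
  (t in P, t in Q), and fixed points, excedances and the growth of alpha can be read off state and letter.

  A 132-avoiding permutation of rank d is determined by the prefix minima m_1 >= ... >= m_d of its
  first d entries and those of its inverse. The sets {m_i - i}, one for the permutation and one for
  its inverse, are the down steps of two ballot sequences of length n. In the walk of such a sequence,
  reflected at 0, the up steps stand for the values d+1, ..., n; an up step is a reflection iff its
  value does not occur among the first d entries, and these values occur in increasing order.

  Finally, the state (b + (ra - rb)^+, a + (rb - ra)^+), with heights a, b and numbers of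
  reflections ra, rb of the two walks, runs through the states of the first encoding backwards.
*)

theory Submission
  imports Defs "HOL-Library.Infinite_Set"
begin

section \<open>Matching the two kinds of words\<close>

text \<open>The merged state rests on a pairing of reflections. The m-th reflection in the walk of
  the permutation gives a value above the rank \<open>d\<close> at a position above
  \<open>d\<close>, and the m-th reflection in the walk of the inverse gives the position of that
  same value. The entry is an excedance iff its position is reflected at an earlier time than its
  value, and a fixed point iff both are reflected at the same time. Hence only the surplus of
  reflections of one walk over the other matters: it is added to the height of the walk that it
  waits for. The times of the two walks can be compared because they share one clock, each having
  made t steps at time t. In \<open>refl_step\<close>, \<open>True\<close> is a down step of the
  ballot sequence and raises the height, which counts the down steps not yet answered by an up step.
  Merging forgets part of the two states; words can still be recovered, because they are rebuilt
  from the earliest step, where both unmerged states are known.\<close>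

fun refl_step :: "bool \<Rightarrow> int \<times> int \<Rightarrow> int \<times> int" where
  "refl_step True (b, r) = (b + 1, r)"
| "refl_step False (b, r) = (if b > 0 then (b - 1, r) else (b, r + 1))"

text \<open>
  A state is the pair of height and number of reflections. The head of the list is the last step.
\<close>

fun refl_walk :: "bool list \<Rightarrow> int \<times> int" where
  "refl_walk [] = (0, 0)"
| "refl_walk (x # xs) = refl_step x (refl_walk xs)"

text \<open>The two maxima differ by \<open>ra - rb\<close>, so the components differ by
  \<open>(b - rb) - (a - ra)\<close>. For walks of equal length this is twice the surplus of
  \<open>True\<close> letters in the second walk; it plays the role of twice alpha - beta, and the
  sum of the components that of 2 h.\<close>

fun merge :: "int \<times> int \<Rightarrow> int \<times> int \<Rightarrow> int \<times> int" where
  "merge (a, ra) (b, rb) = (b + max 0 (ra - rb), a + max 0 (rb - ra))"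

text \<open>
  The letter that leads from the merged state after the step \<open>(x, y)\<close> back to the one before it.
  Here and in \<open>merge\<close>, the first walk is that of the inverse of the 132-avoiding permutation.
\<close>

fun letter :: "bool \<times> bool \<Rightarrow> int \<times> int \<Rightarrow> int \<times> int \<Rightarrow> bool \<times> bool" where
  "letter (x, y) (a, ra) (b, rb) =
     (\<not> y \<and> \<not> (b = 0 \<and> ra \<le> rb),
      x \<or> (a = 0 \<and> (rb < ra \<or> rb = ra \<and> \<not> (\<not> y \<and> b = 0))))"

text \<open>The state stands for \<open>(h + alpha - beta, h + beta - alpha)\<close>. The tests
  \<open>p \<or> y = 0\<close> and \<open>\<not> q \<or> z = 0\<close> decide whether alpha and beta
  grow; h changes by \<open>p\<close> minus \<open>q\<close>.\<close>

fun tstep :: "bool \<times> bool \<Rightarrow> int \<times> int \<Rightarrow> int \<times> int" where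
  "tstep (p, q) (y, z) =
     (y + of_bool p - of_bool q + of_bool (p \<or> y = 0) - of_bool (\<not> q \<or> z = 0),
      z + of_bool p - of_bool q + of_bool (\<not> q \<or> z = 0) - of_bool (p \<or> y = 0))"

text \<open>The sum \<open>y + z\<close> is 2 h, hence even. A letter with \<open>q\<close> closes
  an excedance that was opened earlier, which requires h to be positive.\<close>

fun tvalid :: "bool \<times> bool \<Rightarrow> int \<times> int \<Rightarrow> bool" where
  "tvalid (p, q) (y, z) \<longleftrightarrow> 0 \<le> y \<and> 0 \<le> z \<and> even (y + z) \<and> (q \<longrightarrow> 0 < y + z)"

lemma letter_correct:
  assumes "0 \<le> a" "0 \<le> b" "even (a + b + ra + rb)"
  shows "tvalid (letter (x, y) (a, ra) (b, rb)) (merge (refl_step x (a, ra)) (refl_step y (b, rb)))"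
    and "tstep (letter (x, y) (a, ra) (b, rb)) (merge (refl_step x (a, ra)) (refl_step y (b, rb)))
           = merge (a, ra) (b, rb)"
  using assms by (cases x; cases y; auto simp: max_def; presburger)+

text \<open>Together with \<open>letter_surj\<close>: relative to known unmerged states before the
  step, a step of both walks amounts to a letter and a merged state after it. This makes
  \<open>transfer\<close> invertible entry by entry.\<close>

lemma letter_inj:
  assumes "0 \<le> a" "0 \<le> b"
    and "letter (x, y) (a, ra) (b, rb) = letter (x', y') (a, ra) (b, rb)"
    and "merge (refl_step x (a, ra)) (refl_step y (b, rb)) =
         merge (refl_step x' (a, ra)) (refl_step y' (b, rb))"
  shows "x = x' \<and> y = y'"
  using assms by (cases x; cases y; cases x'; cases y'; auto simp: max_def split: if_splits)

lemma letter_surj: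
  assumes "0 \<le> a" "0 \<le> b" "even (a + b + ra + rb)"
    and "tvalid c w" "tstep c w = merge (a, ra) (b, rb)"
  shows "\<exists>x y. letter (x, y) (a, ra) (b, rb) = c \<and>
               merge (refl_step x (a, ra)) (refl_step y (b, rb)) = w"
proof -
  obtain p q where c: "c = (p, q)" by force
  obtain u v where w: "w = (u, v)" by force
  show ?thesis using assms unfolding c w ex_bool_eq
    by (cases p; cases q; cases "u = 0"; cases "v = 0"; auto simp: max_def split: if_splits; presburger)
qed

fun taccept :: "(bool \<times> bool) list \<Rightarrow> int \<times> int \<Rightarrow> bool" where
  "taccept [] w \<longleftrightarrow> w = (0, 0)"
| "taccept (c # cs) w \<longleftrightarrow> tvalid c w \<and> taccept cs (tstep c w)"

text \<open>The list order is kept, but its head is the last step for the walks and the first letter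
  for \<open>taccept\<close>. This is where time is reversed.\<close>

fun transfer :: "(bool \<times> bool) list \<Rightarrow> (bool \<times> bool) list" where
  "transfer [] = []"
| "transfer (x # xs) = letter x (refl_walk (map fst xs)) (refl_walk (map snd xs)) # transfer xs"

definition merged_state :: "(bool \<times> bool) list \<Rightarrow> int \<times> int" where
  "merged_state xs = merge (refl_walk (map fst xs)) (refl_walk (map snd xs))"

lemma length_transfer [simp]: "length (transfer xs) = length xs"
  by (induction xs) auto

lemma refl_walk_invar:
  assumes "refl_walk xs = (b, r)"
  shows "0 \<le> b \<and> 0 \<le> r \<and> even (b + r + int (length xs))"
  using assms
proof (induction xs arbitrary: b r)
  case (Cons x xs)
  obtain b' r' where w: "refl_walk xs = (b', r')" by force
  show ?case using Cons.IH[OF w] Cons.prems w by (cases x) (auto split: if_splits)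
qed simp

lemma refl_walk_pair:
  obtains a ra b rb where "refl_walk (map fst xs) = (a, ra)" "refl_walk (map snd xs) = (b, rb)"
    "0 \<le> a" "0 \<le> b" "even (a + b + ra + rb)"
proof -
  obtain a ra b rb where w: "refl_walk (map fst xs) = (a, ra)" "refl_walk (map snd xs) = (b, rb)"
    by (meson surj_pair)
  show ?thesis
    using that[OF w] refl_walk_invar[OF w(1)] refl_walk_invar[OF w(2)] by simp (metis (full_types))
qed

lemma transfer_step:
  "tvalid (letter x (refl_walk (map fst xs)) (refl_walk (map snd xs))) (merged_state (x # xs))"
  "tstep (letter x (refl_walk (map fst xs)) (refl_walk (map snd xs))) (merged_state (x # xs))
     = merged_state xs"
proof -
  obtain a ra b rb where "refl_walk (map fst xs) = (a, ra)" "refl_walk (map snd xs) = (b, rb)"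
    "0 \<le> a" "0 \<le> b" "even (a + b + ra + rb)" by (rule refl_walk_pair)
  then show "tvalid (letter x (refl_walk (map fst xs)) (refl_walk (map snd xs))) (merged_state (x # xs))"
    "tstep (letter x (refl_walk (map fst xs)) (refl_walk (map snd xs))) (merged_state (x # xs))
     = merged_state xs"
    unfolding merged_state_def by (cases x; simp only: list.map refl_walk.simps fst_conv snd_conv letter_correct)+
qed

lemma taccept_transfer: "taccept (transfer xs) (merged_state xs)"
  by (induction xs) (simp_all add: transfer_step, simp add: merged_state_def)

lemma transfer_inj:
  assumes "transfer xs = transfer ys" "merged_state xs = merged_state ys"
  shows "xs = ys"
  using assms
proof (induction xs arbitrary: ys)
  case Nil
  then show ?case by (metis length_transfer length_0_conv)
next
  case (Cons x xs)
  then obtain y ys' where ys: "ys = y # ys'"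
    by (cases ys) auto
  \<comment> \<open>Equal first letters applied to equal merged states lead to equal merged states
    of the tails, so the induction hypothesis applies to the tails.\<close>
  have "merged_state xs = merged_state ys'"
    using Cons.prems transfer_step(2)[of x xs] transfer_step(2)[of y ys'] unfolding ys by simp
  then have eq: "xs = ys'" using Cons unfolding ys by simp
  obtain a ra b rb where w: "refl_walk (map fst xs) = (a, ra)" "refl_walk (map snd xs) = (b, rb)"
    "0 \<le> a" "0 \<le> b" "even (a + b + ra + rb)" by (rule refl_walk_pair)
  obtain x1 x2 y1 y2 where "x = (x1, x2)" "y = (y1, y2)" by force
  then show ?case
    using letter_inj[of a b x1 x2 ra rb y1 y2] w Cons.prems
    unfolding ys eq[symmetric] merged_state_def by simp
qed

lemma transfer_surj:
  assumes "taccept cs w"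
  shows "\<exists>xs. transfer xs = cs \<and> merged_state xs = w"
  using assms
proof (induction cs arbitrary: w)
  case Nil
  then show ?case by (intro exI[of _ "[]"]) (simp add: merged_state_def)
next
  case (Cons c cs)
  then obtain xs where xs: "transfer xs = cs" "merged_state xs = tstep c w" "tvalid c w"
    using Cons.IH[of "tstep c w"] by (metis taccept.simps(2))
  obtain a ra b rb where r: "refl_walk (map fst xs) = (a, ra)" "refl_walk (map snd xs) = (b, rb)"
    "0 \<le> a" "0 \<le> b" "even (a + b + ra + rb)" by (rule refl_walk_pair)
  obtain x y where "letter (x, y) (a, ra) (b, rb) = c"
      "merge (refl_step x (a, ra)) (refl_step y (b, rb)) = w"
    using letter_surj[OF r(3-5) xs(3)] xs(2) r(1,2) unfolding merged_state_def by auto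
  then have "transfer ((x, y) # xs) = c # cs \<and> merged_state ((x, y) # xs) = w"
    unfolding merged_state_def using xs r by simp
  then show ?case by blast
qed

text \<open>
  The prefix \<open>t\<close> marks statistics of words for 321-avoiders, \<open>s\<close> those of words for 132-avoiders.
\<close>

fun tfp :: "(bool \<times> bool) list \<Rightarrow> int \<times> int \<Rightarrow> nat" where
  "tfp [] w = 0"
| "tfp (c # cs) w = of_bool (c = (False, False) \<and> w = (0, 0)) + tfp cs (tstep c w)"

fun texc :: "(bool \<times> bool) list \<Rightarrow> nat" where
  "texc [] = 0"
| "texc (c # cs) = of_bool (fst c) + texc cs"

fun tlis :: "(bool \<times> bool) list \<Rightarrow> int \<times> int \<Rightarrow> nat" where
  "tlis [] w = 0"
| "tlis (c # cs) w = of_bool (fst c \<or> fst w = 0) + tlis cs (tstep c w)"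

fun sfp :: "(bool \<times> bool) list \<Rightarrow> nat" where
  "sfp [] = 0"
| "sfp (x # xs) = (case (refl_walk (map fst xs), refl_walk (map snd xs)) of ((a, ra), (b, rb)) \<Rightarrow>
     of_bool (x = (False, False) \<and> a = 0 \<and> b = 0 \<and> ra = rb)) + sfp xs"

fun sexc :: "(bool \<times> bool) list \<Rightarrow> nat" where
  "sexc [] = 0"
| "sexc (x # xs) = (case (refl_walk (map fst xs), refl_walk (map snd xs)) of ((a, ra), (b, rb)) \<Rightarrow>
     of_bool (\<not> snd x \<and> \<not> (b = 0 \<and> ra \<le> rb))) + sexc xs"

lemma texc_transfer: "texc (transfer xs) = sexc xs"
proof (induction xs)
  case (Cons x xs)
  obtain a ra b rb where r: "refl_walk (map fst xs) = (a, ra)" "refl_walk (map snd xs) = (b, rb)"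
    "0 \<le> a" "0 \<le> b" "even (a + b + ra + rb)" by (rule refl_walk_pair)
  show ?case using Cons r by (cases x) simp
qed simp

lemma tfp_transfer: "tfp (transfer xs) (merged_state xs) = sfp xs"
proof (induction xs)
  case (Cons x xs)
  obtain a ra b rb where r: "refl_walk (map fst xs) = (a, ra)" "refl_walk (map snd xs) = (b, rb)"
    "0 \<le> a" "0 \<le> b" "even (a + b + ra + rb)" by (rule refl_walk_pair)
  have "(letter x (a, ra) (b, rb) = (False, False) \<and> merged_state (x # xs) = (0, 0))
      = (x = (False, False) \<and> a = 0 \<and> b = 0 \<and> ra = rb)"
  proof (cases x)
    case (Pair x1 x2)
    then show ?thesis using r(3,4)
      by (cases x1; cases x2; auto simp: merged_state_def r(1,2) max_def split: if_splits)
  qed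
  then show ?case using Cons transfer_step(2)[of x xs] r by simp
qed simp

text \<open>This is the source of the relation between longest increasing subsequence and rank:
  alpha grows exactly at the up steps of the second walk, and a permutation of rank d has n - d of
  them.\<close>

lemma tlis_transfer: "tlis (transfer xs) (merged_state xs) = length (filter (\<lambda>x. \<not> snd x) xs)"
proof (induction xs)
  case (Cons x xs)
  obtain a ra b rb where r: "refl_walk (map fst xs) = (a, ra)" "refl_walk (map snd xs) = (b, rb)"
    "0 \<le> a" "0 \<le> b" "even (a + b + ra + rb)" by (rule refl_walk_pair)
  have "(fst (letter x (a, ra) (b, rb)) \<or> fst (merged_state (x # xs)) = 0) = (\<not> snd x)"
  proof (cases x)
    case (Pair x1 x2)
    then show ?thesis using r(3,4)
      by (cases x1; cases x2; auto simp: merged_state_def r(1,2) max_def split: if_splits)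
  qed
  then show ?case using Cons transfer_step(2)[of x xs] r by simp
qed (simp add: merged_state_def)

lemma merged_state_eq_0_iff:
  "merged_state xs = (0, 0) \<longleftrightarrow>
     (\<exists>r. refl_walk (map fst xs) = (0, r) \<and> refl_walk (map snd xs) = (0, r))"
proof -
  obtain a ra b rb where r: "refl_walk (map fst xs) = (a, ra)" "refl_walk (map snd xs) = (b, rb)"
    "0 \<le> a" "0 \<le> b" "even (a + b + ra + rb)" by (rule refl_walk_pair)
  then show ?thesis by (auto simp: merged_state_def max_def)
qed

lemma bij_betw_transfer:
  "bij_betw transfer
     {xs. length xs = n \<and> (\<exists>r. refl_walk (map fst xs) = (0, r) \<and> refl_walk (map snd xs) = (0, r)) \<and>
          sfp xs = i \<and> sexc xs = j \<and> length (filter (\<lambda>x. \<not> snd x) xs) = k}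
     {cs. length cs = n \<and> taccept cs (0, 0) \<and> tfp cs (0, 0) = i \<and> texc cs = j \<and> tlis cs (0, 0) = k}"
  unfolding bij_betw_def merged_state_eq_0_iff[symmetric]
proof (intro conjI inj_onI set_eqI iffI; clarsimp simp: image_iff)
  fix xs ys assume "transfer xs = transfer ys" "merged_state xs = (0, 0)" "merged_state ys = (0, 0)"
  then show "xs = ys" using transfer_inj by metis
next
  fix xs assume "merged_state xs = (0, 0)"
  then show "taccept (transfer xs) (0, 0) \<and> tfp (transfer xs) (0, 0) = sfp xs \<and>
      texc (transfer xs) = sexc xs \<and> tlis (transfer xs) (0, 0) = length (filter (\<lambda>x. \<not> snd x) xs)"
    using taccept_transfer[of xs] tfp_transfer[of xs] texc_transfer[of xs] tlis_transfer[of xs] by simp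
next
  fix cs assume "taccept cs (0, 0)"
  then obtain xs where xs: "transfer xs = cs" "merged_state xs = (0, 0)" using transfer_surj by blast
  then show "\<exists>xs. length xs = length cs \<and> merged_state xs = (0, 0) \<and> sfp xs = tfp cs (0, 0) \<and>
      sexc xs = texc cs \<and> length (filter (\<lambda>x. \<not> snd x) xs) = tlis cs (0, 0) \<and> cs = transfer xs"
    using tfp_transfer[of xs] texc_transfer[of xs] tlis_transfer[of xs] by (intro exI[of _ xs]) auto
qed

section \<open>321-avoiding permutations\<close>

lemma contains_pattern_3_iff:
  "contains_pattern n \<sigma> 3 (one_line [a, b, c]) \<longleftrightarrow>
     (\<exists>x y z. 1 \<le> x \<and> x < y \<and> y < z \<and> z \<le> n \<and>
        (\<sigma> x < \<sigma> y \<longleftrightarrow> a < b) \<and> (\<sigma> y < \<sigma> x \<longleftrightarrow> b < a) \<and>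
        (\<sigma> x < \<sigma> z \<longleftrightarrow> a < c) \<and> (\<sigma> z < \<sigma> x \<longleftrightarrow> c < a) \<and>
        (\<sigma> y < \<sigma> z \<longleftrightarrow> b < c) \<and> (\<sigma> z < \<sigma> y \<longleftrightarrow> c < b))"
  (is "?L \<longleftrightarrow> ?R")
proof -
  have three: "{1..3::nat} = {1, 2, 3}" by auto
  have vals: "one_line [a, b, c] 1 = a" "one_line [a, b, c] 2 = b" "one_line [a, b, c] 3 = c"
    by (simp_all add: one_line_def)
  show ?thesis
  proof
    assume ?L
    then obtain p where "strict_mono_on {1..3::nat} p" "p ` {1..3} \<subseteq> {1..n}"
      "\<forall>x\<in>{1..3}. \<forall>y\<in>{1..3}. \<sigma> (p x) < \<sigma> (p y) \<longleftrightarrow> one_line [a, b, c] x < one_line [a, b, c] y"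
      unfolding contains_pattern_def by blast
    then show ?R
      by (intro exI[of _ "p 1"] exI[of _ "p 2"] exI[of _ "p 3"])
        (simp add: three vals strict_mono_on_def del: One_nat_def)
  next
    assume ?R
    then obtain x y z where xyz: "1 \<le> x" "x < y" "y < z" "z \<le> n"
        "\<sigma> x < \<sigma> y \<longleftrightarrow> a < b" "\<sigma> y < \<sigma> x \<longleftrightarrow> b < a"
        "\<sigma> x < \<sigma> z \<longleftrightarrow> a < c" "\<sigma> z < \<sigma> x \<longleftrightarrow> c < a"
        "\<sigma> y < \<sigma> z \<longleftrightarrow> b < c" "\<sigma> z < \<sigma> y \<longleftrightarrow> c < b" by blast
    define p :: "nat \<Rightarrow> nat" where "p i = (if i = 1 then x else if i = 2 then y else z)" for i
    have p: "p 1 = x" "p 2 = y" "p 3 = z" by (simp_all add: p_def)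
    show ?L unfolding contains_pattern_def
      by (intro exI[of _ p]) (use xyz in \<open>auto simp: three vals p strict_mono_on_def simp del: One_nat_def\<close>)
  qed
qed

definition avoids_321 :: "nat \<Rightarrow> (nat \<Rightarrow> nat) \<Rightarrow> bool" where
  "avoids_321 n \<sigma> \<longleftrightarrow> (\<forall>x y z. 1 \<le> x \<longrightarrow> x < y \<longrightarrow> y < z \<longrightarrow> z \<le> n \<longrightarrow> \<sigma> z < \<sigma> y \<longrightarrow> \<sigma> y < \<sigma> x \<longrightarrow> False)"

definition avoids_132 :: "nat \<Rightarrow> (nat \<Rightarrow> nat) \<Rightarrow> bool" where
  "avoids_132 n \<sigma> \<longleftrightarrow> (\<forall>x y z. 1 \<le> x \<longrightarrow> x < y \<longrightarrow> y < z \<longrightarrow> z \<le> n \<longrightarrow> \<sigma> x < \<sigma> z \<longrightarrow> \<sigma> z < \<sigma> y \<longrightarrow> False)"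

lemma avoiders_321: "avoiders n [3, 2, 1] = {\<sigma>. \<sigma> permutes {1..n} \<and> avoids_321 n \<sigma>}"
proof -
  have "contains_pattern n \<sigma> 3 (one_line [3, 2, 1]) \<longleftrightarrow> \<not> avoids_321 n \<sigma>" for \<sigma>
  proof -
    have "((\<sigma> x < \<sigma> y \<longleftrightarrow> (3::nat) < 2) \<and> (\<sigma> y < \<sigma> x \<longleftrightarrow> (2::nat) < 3) \<and>
        (\<sigma> x < \<sigma> z \<longleftrightarrow> (3::nat) < 1) \<and> (\<sigma> z < \<sigma> x \<longleftrightarrow> (1::nat) < 3) \<and>
        (\<sigma> y < \<sigma> z \<longleftrightarrow> (2::nat) < 1) \<and> (\<sigma> z < \<sigma> y \<longleftrightarrow> (1::nat) < 2)) \<longleftrightarrow> \<sigma> z < \<sigma> y \<and> \<sigma> y < \<sigma> x"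
      for x y z by auto
    then show ?thesis unfolding contains_pattern_3_iff avoids_321_def by blast
  qed
  then show ?thesis by (simp add: avoiders_def eval_nat_numeral)
qed

lemma avoiders_132: "avoiders n [1, 3, 2] = {\<sigma>. \<sigma> permutes {1..n} \<and> avoids_132 n \<sigma>}"
proof -
  have "contains_pattern n \<sigma> 3 (one_line [1, 3, 2]) \<longleftrightarrow> \<not> avoids_132 n \<sigma>" for \<sigma>
  proof -
    have "((\<sigma> x < \<sigma> y \<longleftrightarrow> (1::nat) < 3) \<and> (\<sigma> y < \<sigma> x \<longleftrightarrow> (3::nat) < 1) \<and>
        (\<sigma> x < \<sigma> z \<longleftrightarrow> (1::nat) < 2) \<and> (\<sigma> z < \<sigma> x \<longleftrightarrow> (2::nat) < 1) \<and>
        (\<sigma> y < \<sigma> z \<longleftrightarrow> (3::nat) < 2) \<and> (\<sigma> z < \<sigma> y \<longleftrightarrow> (2::nat) < 3)) \<longleftrightarrow> \<sigma> x < \<sigma> z \<and> \<sigma> z < \<sigma> y"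
      for x y z by auto
    then show ?thesis unfolding contains_pattern_3_iff avoids_132_def by blast
  qed
  then show ?thesis by (simp add: avoiders_def eval_nat_numeral)
qed

section \<open>Records, crossings and longest increasing subsequences of 321-avoiders\<close>

lemma permutes_inv_facts:
  assumes "\<sigma> permutes {1..n::nat}"
  shows "\<sigma> x \<in> {1..n} \<longleftrightarrow> x \<in> {1..n}" "inv \<sigma> x \<in> {1..n} \<longleftrightarrow> x \<in> {1..n}"
    "\<sigma> (inv \<sigma> x) = x" "inv \<sigma> (\<sigma> x) = x" "\<sigma> x = \<sigma> y \<longleftrightarrow> x = y" "inv \<sigma> x = inv \<sigma> y \<longleftrightarrow> x = y"
  by (rule permutes_in_image[OF assms] permutes_in_image[OF permutes_inv[OF assms]]
      permutes_inverses[OF assms] inj_eq[OF permutes_inj[OF assms]]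
      inj_eq[OF permutes_inj[OF permutes_inv[OF assms]]])+

lemma avoids_321_inv:
  assumes p: "\<sigma> permutes {1..n}" and "avoids_321 n \<sigma>"
  shows "avoids_321 n (inv \<sigma>)"
  unfolding avoids_321_def
proof (intro allI impI)
  fix x y z :: nat
  assume *: "1 \<le> x" "x < y" "y < z" "z \<le> n" "inv \<sigma> z < inv \<sigma> y" "inv \<sigma> y < inv \<sigma> x"
  note P = permutes_inv_facts[OF p]
  have "1 \<le> inv \<sigma> z" "inv \<sigma> x \<le> n" using * P(2)[of z] P(2)[of x] by auto
  moreover have "\<sigma> (inv \<sigma> x) < \<sigma> (inv \<sigma> y)" "\<sigma> (inv \<sigma> y) < \<sigma> (inv \<sigma> z)"
    unfolding P(3) using * by auto
  ultimately show False
    using assms(2) *(5,6) unfolding avoids_321_def by blast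
qed

text \<open>A larger entry at \<open>w\<close> would force all entries to the right of
  \<open>x\<close> above \<open>\<sigma> x\<close>. Then the values
  \<open>1, ..., \<sigma> x\<close> would have to fit into the positions up to \<open>x\<close>
  other than \<open>w\<close>, which are fewer than \<open>\<sigma> x\<close>.\<close>

lemma weak_excedance_is_record:
  assumes p: "\<sigma> permutes {1..n}" and av: "avoids_321 n \<sigma>"
    and x: "x \<le> n" "x \<le> \<sigma> x" and w: "1 \<le> w" "w < x"
  shows "\<sigma> w < \<sigma> x"
proof (rule ccontr)
  note P = permutes_inv_facts[OF p]
  assume "\<not> \<sigma> w < \<sigma> x"
  then have gt: "\<sigma> x < \<sigma> w" using P(5)[of w x] w by linarith
  have gtx: "\<sigma> x < \<sigma> z" if "x < z" "z \<le> n" for z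
    using av gt w that P(5)[of x z] unfolding avoids_321_def by (metis less_irrefl nat_neq_iff)
  have "inv \<sigma> v \<in> {1..x} - {w}" if "v \<in> {1..\<sigma> x}" for v
  proof -
    have "\<sigma> x \<le> n" using P(1)[of x] x w by simp
    then have "inv \<sigma> v \<in> {1..n}" using P(2)[of v] that by simp
    moreover have "\<not> x < inv \<sigma> v"
      using gtx[of "inv \<sigma> v"] P(3)[of v] that calculation by auto
    ultimately show ?thesis using P(3)[of v] gt that by auto
  qed
  then have "inv \<sigma> ` {1..\<sigma> x} \<subseteq> {1..x} - {w}" by blast
  then have "card (inv \<sigma> ` {1..\<sigma> x}) \<le> card ({1..x} - {w})" by (intro card_mono) auto
  moreover have "card (inv \<sigma> ` {1..\<sigma> x}) = \<sigma> x"
    using P(6) by (subst card_image) (auto simp: inj_on_def)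
  ultimately show False using w x by simp
qed

text \<open>Mirror image of the previous count: a smaller entry at \<open>w\<close> would force all
  entries to the left of \<open>x\<close> below \<open>\<sigma> x\<close>, so \<open>x\<close>
  positions would share fewer than \<open>x\<close> values.\<close>

lemma weak_deficiency_is_record:
  assumes p: "\<sigma> permutes {1..n}" and av: "avoids_321 n \<sigma>"
    and x: "1 \<le> x" "\<sigma> x \<le> x" and w: "x < w" "w \<le> n"
  shows "\<sigma> x < \<sigma> w"
proof (rule ccontr)
  note P = permutes_inv_facts[OF p]
  assume "\<not> \<sigma> x < \<sigma> w"
  then have gt: "\<sigma> w < \<sigma> x" using P(5)[of w x] w by linarith
  have "\<sigma> z < \<sigma> x" if "1 \<le> z" "z < x" for z
    using av gt w that P(5)[of x z] unfolding avoids_321_def by (metis less_irrefl nat_neq_iff)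
  moreover have "1 \<le> \<sigma> z" if "1 \<le> z" "z \<le> n" for z using P(1)[of z] that by simp
  ultimately have "\<sigma> ` ({1..<x} \<union> {w}) \<subseteq> {1..<\<sigma> x}"
    using w x gt by (auto simp del: One_nat_def)
  then have "card (\<sigma> ` ({1..<x} \<union> {w})) \<le> card {1..<\<sigma> x}" by (intro card_mono) auto
  moreover have "card (\<sigma> ` ({1..<x} \<union> {w})) = card ({1..<x} \<union> {w})"
    using P(5) by (subst card_image) (auto simp: inj_on_def)
  ultimately show False using w x by simp
qed

lemma card_le_lis: "S \<subseteq> {1..n} \<Longrightarrow> strict_mono_on S \<sigma> \<Longrightarrow> card S \<le> lis n \<sigma>"
  unfolding lis_def by (intro Max_ge) auto

lemma lis_attained:
  obtains S where "S \<subseteq> {1..n}" "strict_mono_on S \<sigma>" "card S = lis n \<sigma>"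
proof -
  have "lis n \<sigma> \<in> {card S | S. S \<subseteq> {1..n} \<and> strict_mono_on S \<sigma>}"
    unfolding lis_def by (intro Max_in) (auto intro!: exI[of _ "{}"])
  then show ?thesis using that by auto
qed

definition crossing :: "(nat \<Rightarrow> nat) \<Rightarrow> nat \<Rightarrow> nat" where
  "crossing \<sigma> t = card {x \<in> {1..t}. t < \<sigma> x}"

text \<open>The square of positions and values up to \<open>t\<close> misses as many of its columns
  as of its rows, so as many points lie above it as to the right of it.\<close>

lemma crossing_alt:
  assumes p: "\<sigma> permutes {1..n}" and "t \<le> n"
  shows "crossing \<sigma> t = card {x \<in> {Suc t..n}. \<sigma> x \<le> t}" "crossing (inv \<sigma>) t = crossing \<sigma> t"
proof -
  note P = permutes_inv_facts[OF p]
  let ?A = "{x \<in> {1..t}. t < \<sigma> x}" and ?B = "{x \<in> {1..t}. \<sigma> x \<le> t}" and ?C = "{x \<in> {Suc t..n}. \<sigma> x \<le> t}"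
  have "?A \<union> ?B = {1..t}" "?A \<inter> ?B = {}" by auto
  then have 1: "card ?A + card ?B = t" 
    by (metis (no_types, lifting) card_Un_disjoint card_atLeastAtMost diff_Suc_1 finite_Un finite_atLeastAtMost)
  have "\<sigma> ` (?B \<union> ?C) = {1..t}"
  proof (intro equalityI subsetI)
    fix v assume "v \<in> {1..t}"
    then have "inv \<sigma> v \<in> ?B \<union> ?C" using P(2)[of v] P(3) \<open>t \<le> n\<close> by auto
    then show "v \<in> \<sigma> ` (?B \<union> ?C)" using P(3)[of v] image_eqI[of v \<sigma> "inv \<sigma> v"] by simp
  next
    fix v assume "v \<in> \<sigma> ` (?B \<union> ?C)"
    then obtain x where x: "v = \<sigma> x" "1 \<le> x" "x \<le> n" "\<sigma> x \<le> t" using \<open>t \<le> n\<close> by auto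
    then show "v \<in> {1..t}" using P(1)[of x] by simp
  qed
  then have "card (?B \<union> ?C) = t"
    using card_image[of \<sigma> "?B \<union> ?C"] P(5) by (simp add: inj_on_def)
  moreover have "card (?B \<union> ?C) = card ?B + card ?C" by (rule card_Un_disjoint) auto
  ultimately show c: "crossing \<sigma> t = card ?C" using 1 unfolding crossing_def by simp
  have "{v \<in> {1..t}. t < inv \<sigma> v} = \<sigma> ` ?C"
  proof (intro equalityI subsetI)
    fix v assume v: "v \<in> {v \<in> {1..t}. t < inv \<sigma> v}"
    then have "inv \<sigma> v \<in> ?C" using P(2)[of v] P(3) \<open>t \<le> n\<close> by auto
    then show "v \<in> \<sigma> ` ?C" using P(3)[of v] image_eqI[of v \<sigma> "inv \<sigma> v"] by simp
  next
    fix v assume "v \<in> \<sigma> ` ?C"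
    then obtain x where x: "v = \<sigma> x" "Suc t \<le> x" "x \<le> n" "\<sigma> x \<le> t" by auto
    then show "v \<in> {v \<in> {1..t}. t < inv \<sigma> v}" using P(1)[of x] P(4) by auto
  qed
  then show "crossing (inv \<sigma>) t = crossing \<sigma> t"
    unfolding c using card_image[of \<sigma> ?C] P(5) by (simp add: inj_on_def crossing_def)
qed

lemma crossing_0 [simp]: "crossing \<sigma> 0 = 0"
  by (simp add: crossing_def)

lemma crossing_Suc:
  assumes p: "\<sigma> permutes {1..n}" and "Suc t \<le> n"
  shows "crossing \<sigma> (Suc t) + of_bool (inv \<sigma> (Suc t) < Suc t) = crossing \<sigma> t + of_bool (Suc t < \<sigma> (Suc t))"
    and "inv \<sigma> (Suc t) < Suc t \<Longrightarrow> 0 < crossing \<sigma> t"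
proof -
  note P = permutes_inv_facts[OF p]
  define A where "A = {x \<in> {1..t}. t < \<sigma> x}"
  define i where "i = inv \<sigma> (Suc t)"
  have i: "\<sigma> i = Suc t" "1 \<le> i" "i \<le> n" using P(2)[of "Suc t"] P(3) assms(2) by (auto simp: i_def)
  have fin: "finite A" by (simp add: A_def)
  have iA: "i \<in> A \<longleftrightarrow> i < Suc t" using i by (auto simp: A_def)
  have "{x \<in> {1..Suc t}. Suc t < \<sigma> x} = (A - {i}) \<union> (if Suc t < \<sigma> (Suc t) then {Suc t} else {})"
  proof -
    have "Suc t < \<sigma> x \<longleftrightarrow> t < \<sigma> x \<and> x \<noteq> i" for x using i(1) P(5)[of x i] by auto
    then show ?thesis unfolding A_def by (auto simp: le_Suc_eq)
  qed
  then have "card {x \<in> {1..Suc t}. Suc t < \<sigma> x} = card (A - {i}) + of_bool (Suc t < \<sigma> (Suc t))"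
    using fin by (auto simp: A_def)
  moreover have "card (A - {i}) + of_bool (i < Suc t) = card A"
    using iA card_Suc_Diff1[OF fin, of i] by (cases "i \<in> A") simp_all
  ultimately show "crossing \<sigma> (Suc t) + of_bool (i < Suc t) = crossing \<sigma> t + of_bool (Suc t < \<sigma> (Suc t))"
    unfolding crossing_def A_def[symmetric] by linarith
  show "i < Suc t \<Longrightarrow> 0 < crossing \<sigma> t"
    unfolding crossing_def A_def[symmetric] using iA fin by (auto simp: card_gt_0_iff)
qed

lemma strict_mono_on_inv_image:
  fixes \<sigma> :: "nat \<Rightarrow> nat"
  assumes "\<sigma> permutes A" "strict_mono_on K \<sigma>"
  shows "strict_mono_on (\<sigma> ` K) (inv \<sigma>)"
  unfolding strict_mono_on_def
proof (intro allI impI, elim conjE imageE)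
  fix u v r s assume *: "u < v" "u = \<sigma> r" "v = \<sigma> s" "r \<in> K" "s \<in> K"
  have "\<not> s \<le> r"
  proof
    assume "s \<le> r"
    then consider "s = r" | "s < r" by linarith
    then show False using * assms(2) by cases (auto simp: strict_mono_on_def dest: less_asym)
  qed
  then show "inv \<sigma> u < inv \<sigma> v" using * permutes_inverses(2)[OF assms(1)] by simp
qed

lemma lis_0 [simp]: "lis 0 \<sigma> = 0"
  by (metis lis_attained atLeastatMost_empty card.empty subset_empty zero_less_one)

lemma lis_le_Suc: "lis t \<sigma> \<le> lis (Suc t) \<sigma>"
proof -
  obtain S where "S \<subseteq> {1..t}" "strict_mono_on S \<sigma>" "card S = lis t \<sigma>" by (rule lis_attained)
  then show ?thesis using card_le_lis[of S "Suc t" \<sigma>] by fastforce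
qed

lemma lis_Suc_le: "lis (Suc t) \<sigma> \<le> Suc (lis t \<sigma>)"
proof -
  obtain S where S: "S \<subseteq> {1..Suc t}" "strict_mono_on S \<sigma>" "card S = lis (Suc t) \<sigma>"
    by (rule lis_attained)
  then have "card (S - {Suc t}) \<le> lis t \<sigma>"
    by (intro card_le_lis) (auto simp: strict_mono_on_def le_Suc_eq)
  moreover have "card S \<le> Suc (card (S - {Suc t}))"
    using card_Suc_Diff1[of S "Suc t"] finite_subset[OF S(1)] by (cases "Suc t \<in> S") auto
  ultimately show ?thesis using S by linarith
qed

lemma lis_Suc_weak_excedance:
  assumes p: "\<sigma> permutes {1..n}" and av: "avoids_321 n \<sigma>"
    and "Suc t \<le> n" "Suc t \<le> \<sigma> (Suc t)"
  shows "lis (Suc t) \<sigma> = Suc (lis t \<sigma>)"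
proof -
  obtain S where S: "S \<subseteq> {1..t}" "strict_mono_on S \<sigma>" "card S = lis t \<sigma>"
    by (rule lis_attained)
  have "\<sigma> x < \<sigma> (Suc t)" if "x \<in> S" for x
    using weak_excedance_is_record[OF p av assms(3,4), of x] S(1) that by auto
  then have "strict_mono_on (insert (Suc t) S) \<sigma>"
    using S(1,2) by (fastforce simp: strict_mono_on_def)
  then have "card (insert (Suc t) S) \<le> lis (Suc t) \<sigma>"
    using S(1) by (intro card_le_lis) auto
  moreover have "finite S" "Suc t \<notin> S" using S(1) finite_subset by auto
  ultimately show ?thesis using S(3) lis_Suc_le[of t \<sigma>] by simp
qed

text \<open>An increasing subsequence among the values up to \<open>t\<close> splits into positions
  up to \<open>t\<close> and positions beyond \<open>t\<close>; the latter are at most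
  \<open>crossing \<sigma> t\<close> many. Equality forces it to use every position of the second
  kind, together with a longest subsequence of the first kind.\<close>

lemma lis_inv_le:
  assumes p: "\<sigma> permutes {1..n}" and t: "t \<le> n"
  shows "lis t (inv \<sigma>) \<le> lis t \<sigma> + crossing \<sigma> t"
    and "lis t (inv \<sigma>) = lis t \<sigma> + crossing \<sigma> t \<Longrightarrow>
      \<exists>K \<subseteq> {1..t}. strict_mono_on (K \<union> {x \<in> {Suc t..n}. \<sigma> x \<le> t}) \<sigma> \<and> card K = lis t \<sigma>"
proof -
  note P = permutes_inv_facts[OF p]
  let ?O = "{x \<in> {Suc t..n}. \<sigma> x \<le> t}"
  obtain S where S: "S \<subseteq> {1..t}" "strict_mono_on S (inv \<sigma>)" "card S = lis t (inv \<sigma>)"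
    by (rule lis_attained)
  define K where "K = inv \<sigma> ` S"
  have finS: "finite S" using S(1) finite_subset by blast
  have cK: "card K = lis t (inv \<sigma>)"
    unfolding K_def S(3)[symmetric] by (rule card_image) (use P(6) in \<open>auto simp: inj_on_def\<close>)
  have mono: "strict_mono_on K \<sigma>"
    using strict_mono_on_inv_image[OF permutes_inv[OF p] S(2)] permutes_inv_inv[OF p]
    by (simp add: K_def)
  have sub: "K - {1..t} \<subseteq> ?O"
  proof
    fix x assume x: "x \<in> K - {1..t}"
    then obtain v where v: "x = inv \<sigma> v" "v \<in> S" unfolding K_def by auto
    then have "v \<in> {1..t}" using S(1) by auto
    then show "x \<in> ?O" using x v P(2)[of v] P(3)[of v] t by auto
  qed
  have fin: "finite K" using finS by (simp add: K_def)
  have split: "card K = card (K \<inter> {1..t}) + card (K - {1..t})"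
    using card_Int_Diff[OF fin] by simp
  have 1: "card (K \<inter> {1..t}) \<le> lis t \<sigma>"
    using mono by (intro card_le_lis) (auto simp: strict_mono_on_def)
  have 2: "card (K - {1..t}) \<le> crossing \<sigma> t"
    unfolding crossing_alt(1)[OF p t] using sub by (intro card_mono) auto
  show "lis t (inv \<sigma>) \<le> lis t \<sigma> + crossing \<sigma> t" using split 1 2 cK by linarith
  assume "lis t (inv \<sigma>) = lis t \<sigma> + crossing \<sigma> t"
  then have "card (K \<inter> {1..t}) = lis t \<sigma>" "card (K - {1..t}) = card ?O"
    using split 1 2 cK unfolding crossing_alt(1)[OF p t] by linarith+
  moreover have "K - {1..t} = ?O"
    by (rule card_subset_eq) (use sub calculation in auto)
  then have "(K \<inter> {1..t}) \<union> ?O = K" by auto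
  ultimately show "\<exists>K \<subseteq> {1..t}. strict_mono_on (K \<union> ?O) \<sigma> \<and> card K = lis t \<sigma>"
    using mono by (intro exI[of _ "K \<inter> {1..t}"]) auto
qed

text \<open>Position \<open>Suc t\<close> is one of the positions beyond \<open>t\<close> with value
  at most \<open>t\<close>. In the case of equality it therefore extends the subsequence supplied by
  \<open>lis_inv_le\<close>; otherwise an extension would itself yield equality.\<close>

lemma lis_Suc_deficiency:
  assumes p: "\<sigma> permutes {1..n}" and av: "avoids_321 n \<sigma>"
    and "Suc t \<le> n" "\<sigma> (Suc t) \<le> t"
  shows "lis (Suc t) \<sigma> = lis t \<sigma> + of_bool (lis t (inv \<sigma>) = lis t \<sigma> + crossing \<sigma> t)"
proof -
  note P = permutes_inv_facts[OF p]
  have t: "t \<le> n" using assms(3) by simp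
  let ?O = "{x \<in> {Suc t..n}. \<sigma> x \<le> t}"
  have zO: "Suc t \<in> ?O" using assms by simp
  show ?thesis
  proof (cases "lis t (inv \<sigma>) = lis t \<sigma> + crossing \<sigma> t")
    case True
    then obtain K where K: "K \<subseteq> {1..t}" "strict_mono_on (K \<union> ?O) \<sigma>" "card K = lis t \<sigma>"
      using lis_inv_le(2)[OF p t] by blast
    have "strict_mono_on (insert (Suc t) K) \<sigma>"
      using monotone_on_subset[OF K(2), of "insert (Suc t) K"] zO by blast
    then have "card (insert (Suc t) K) \<le> lis (Suc t) \<sigma>"
      using K(1) by (intro card_le_lis) auto
    moreover have "finite K" "Suc t \<notin> K" using K(1) finite_subset by auto
    ultimately show ?thesis using K(3) lis_Suc_le[of t \<sigma>] True by simp
  next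
    case False
    have "lis (Suc t) \<sigma> \<noteq> Suc (lis t \<sigma>)"
    proof
      assume eq: "lis (Suc t) \<sigma> = Suc (lis t \<sigma>)"
      obtain K where K: "K \<subseteq> {1..Suc t}" "strict_mono_on K \<sigma>" "card K = lis (Suc t) \<sigma>"
        by (rule lis_attained)
      have "Suc t \<in> K"
      proof (rule ccontr)
        assume "Suc t \<notin> K"
        then have "K \<subseteq> {1..t}" using K(1) by (auto simp: le_Suc_eq)
        then show False using card_le_lis[OF _ K(2), of t] K(3) eq by simp
      qed
      have Kz: "\<sigma> x \<le> \<sigma> (Suc t)" if "x \<in> K" for x
        using K(1,2) that \<open>Suc t \<in> K\<close> by (metis atLeastAtMost_iff le_eq_less_or_eq strict_mono_on_def subsetD)
      have Oz: "\<sigma> (Suc t) < \<sigma> w" if "w \<in> ?O" "w \<noteq> Suc t" for w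
        using weak_deficiency_is_record[OF p av, of "Suc t" w] assms(4) that by auto
      have OO: "\<sigma> v < \<sigma> w" if "w \<in> ?O" "v \<in> ?O" "v < w" for v w
        using weak_deficiency_is_record[OF p av, of v w] that by auto
      \<comment> \<open>A longest subsequence \<open>K\<close> must end at \<open>Suc t\<close>, so
        all its values are at most \<open>t\<close>. The members of \<open>?O\<close> are
        deficiencies, hence increasing, and can be appended; they share only \<open>Suc t\<close>
        with \<open>K\<close>.\<close>
      have mono: "strict_mono_on (K \<union> ?O) \<sigma>"
        unfolding strict_mono_on_def
      proof (intro allI impI, elim conjE)
        fix r s assume rs: "r \<in> K \<union> ?O" "s \<in> K \<union> ?O" "r < s"
        then consider "r \<in> K" "s \<in> K" | "r \<in> ?O" "s \<in> ?O" | "r \<in> K" "s \<in> ?O" "s \<noteq> Suc t"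
          using K(1) \<open>Suc t \<in> K\<close> zO by fastforce
        then show "\<sigma> r < \<sigma> s"
        proof cases
          case 1 then show ?thesis using K(2) rs(3) by (auto simp: strict_mono_on_def)
        next
          case 2 then show ?thesis using OO rs(3) by blast
        next
          case 3 then show ?thesis using Kz[of r] Oz[of s] by linarith
        qed
      qed
      have rng: "x \<in> {1..n} \<and> \<sigma> x \<in> {1..t}" if "x \<in> K \<union> ?O" for x
      proof -
        have "x \<in> {1..n}" using that K(1) assms(3) by auto
        moreover have "\<sigma> x \<le> t" using that Kz[of x] assms(4) by auto
        ultimately show ?thesis using P(1)[of x] by simp
      qed
      have inv_mono: "strict_mono_on (\<sigma> ` (K \<union> ?O)) (inv \<sigma>)"
        by (rule strict_mono_on_inv_image[OF p mono])
      have "card (\<sigma> ` (K \<union> ?O)) \<le> lis t (inv \<sigma>)"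
        using rng by (intro card_le_lis inv_mono) blast
      moreover have "card (\<sigma> ` (K \<union> ?O)) = card (K \<union> ?O)"
        by (rule card_image) (use P(5) in \<open>auto simp: inj_on_def\<close>)
      moreover have "card (K \<union> ?O) + card (K \<inter> ?O) = card K + card ?O"
        by (rule card_Un_Int[symmetric]) (use K(1) finite_subset in auto)
      moreover have "K \<inter> ?O = {Suc t}" using K(1) zO \<open>Suc t \<in> K\<close> by fastforce
      ultimately have "lis t \<sigma> + crossing \<sigma> t \<le> lis t (inv \<sigma>)"
        using K(3) eq crossing_alt(1)[OF p t] by simp
      then show False using False lis_inv_le(1)[OF p t] by simp
    qed
    then show ?thesis using False lis_Suc_le[of t \<sigma>] lis_le_Suc[of t \<sigma>] by simp
  qed
qed

lemma crossing_at_fixed_point: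
  assumes p: "\<sigma> permutes {1..n}" and av: "avoids_321 n \<sigma>"
    and "Suc t \<le> n" "\<sigma> (Suc t) = Suc t"
  shows "crossing \<sigma> t = 0"
proof -
  note P = permutes_inv_facts[OF p]
  have "\<sigma> x < Suc t" if "1 \<le> x" "x \<le> t" for x
    using weak_excedance_is_record[OF p av, of "Suc t" x] assms that by auto
  then show ?thesis unfolding crossing_def by (auto simp: card_eq_0_iff) (meson leD less_Suc_eq_le)
qed

text \<open>At a fixed point no crossing is open, so both lengths agree and the second disjunct
  holds. Hence one test covers excedances, fixed points and deficiencies.\<close>

lemma lis_Suc_eq:
  assumes p: "\<sigma> permutes {1..n}" and av: "avoids_321 n \<sigma>" and t: "Suc t \<le> n"
  shows "lis (Suc t) \<sigma> = lis t \<sigma> +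
    of_bool (Suc t < \<sigma> (Suc t) \<or> lis t (inv \<sigma>) = lis t \<sigma> + crossing \<sigma> t)"
proof -
  consider "Suc t < \<sigma> (Suc t)" | "\<sigma> (Suc t) = Suc t" | "\<sigma> (Suc t) \<le> t" by linarith
  then show ?thesis
  proof cases
    case 1 then show ?thesis using lis_Suc_weak_excedance[OF p av t] by simp
  next
    case 2
    have "t \<le> n" using t by simp
    note le = lis_inv_le(1)[OF p this] lis_inv_le(1)[OF permutes_inv[OF p] this]
    have "lis t (inv \<sigma>) = lis t \<sigma>"
      using le crossing_alt(2)[OF p \<open>t \<le> n\<close>] crossing_at_fixed_point[OF p av t 2]
      by (simp add: permutes_inv_inv[OF p])
    then show ?thesis using lis_Suc_weak_excedance[OF p av t] 2 crossing_at_fixed_point[OF p av t 2] by simp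
  next
    case 3 then show ?thesis using lis_Suc_deficiency[OF p av t] by simp
  qed
qed

section \<open>The word of a 321-avoider\<close>

text \<open>Positions start at 1, list indices and hence the index \<open>t\<close> of a letter at 0.\<close>

definition letter_321 :: "(nat \<Rightarrow> nat) \<Rightarrow> nat \<Rightarrow> bool \<times> bool" where
  "letter_321 \<sigma> t = (Suc t < \<sigma> (Suc t), inv \<sigma> (Suc t) < Suc t)"

definition word_321 :: "nat \<Rightarrow> (nat \<Rightarrow> nat) \<Rightarrow> (bool \<times> bool) list" where
  "word_321 n \<sigma> = map (letter_321 \<sigma>) [0..<n]"

definition state_321 :: "(nat \<Rightarrow> nat) \<Rightarrow> nat \<Rightarrow> int \<times> int" where
  "state_321 \<sigma> t = (int (crossing \<sigma> t) + int (lis t \<sigma>) - int (lis t (inv \<sigma>)),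
                     int (crossing \<sigma> t) + int (lis t (inv \<sigma>)) - int (lis t \<sigma>))"

context
  fixes \<sigma> :: "nat \<Rightarrow> nat" and n :: nat
  assumes p: "\<sigma> permutes {1..n}" and av: "avoids_321 n \<sigma>"
begin

lemma state_321_step:
  assumes t: "Suc t \<le> n"
  shows "tvalid (letter_321 \<sigma> t) (state_321 \<sigma> t)"
    and "tstep (letter_321 \<sigma> t) (state_321 \<sigma> t) = state_321 \<sigma> (Suc t)"
    and "letter_321 \<sigma> t = (False, False) \<and> state_321 \<sigma> t = (0, 0) \<longleftrightarrow> \<sigma> (Suc t) = Suc t"
    and "lis (Suc t) \<sigma> = lis t \<sigma> + of_bool (fst (letter_321 \<sigma> t) \<or> fst (state_321 \<sigma> t) = 0)"
proof -
  note P = permutes_inv_facts[OF p]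
  have tn: "t \<le> n" using t by simp
  note pi = permutes_inv[OF p] and ii = permutes_inv_inv[OF p]
  note c = crossing_alt[OF p tn]
  have le: "lis t (inv \<sigma>) \<le> lis t \<sigma> + crossing \<sigma> t" "lis t \<sigma> \<le> lis t (inv \<sigma>) + crossing \<sigma> t"
    using lis_inv_le(1)[OF p tn] lis_inv_le(1)[OF pi tn] by (simp_all add: ii c(2))
  have l1: "lis (Suc t) \<sigma> = lis t \<sigma> +
      of_bool (Suc t < \<sigma> (Suc t) \<or> lis t (inv \<sigma>) = lis t \<sigma> + crossing \<sigma> t)"
    by (rule lis_Suc_eq[OF p av t])
  have l2: "lis (Suc t) (inv \<sigma>) = lis t (inv \<sigma>) +
      of_bool (Suc t < inv \<sigma> (Suc t) \<or> lis t \<sigma> = lis t (inv \<sigma>) + crossing \<sigma> t)"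
    using lis_Suc_eq[OF pi avoids_321_inv[OF p av] t] by (simp add: ii c(2))
  note cs = crossing_Suc[OF p t]
  have fixed: "crossing \<sigma> t = 0" if "\<sigma> (Suc t) = Suc t"
    by (rule crossing_at_fixed_point[OF p av t that])
  have fixed_iff: "\<sigma> (Suc t) = Suc t \<longleftrightarrow> inv \<sigma> (Suc t) = Suc t" using P(3,4) by metis
  have nonfixed: "crossing \<sigma> t > 0" if "\<sigma> (Suc t) \<le> t"
  proof -
    have "Suc t \<in> {x \<in> {Suc t..n}. \<sigma> x \<le> t}" using that t by auto
    then show ?thesis unfolding c(1) card_gt_0_iff by auto
  qed
  show "tvalid (letter_321 \<sigma> t) (state_321 \<sigma> t)"
    using le cs(2) by (auto simp: letter_321_def state_321_def)
  show "letter_321 \<sigma> t = (False, False) \<and> state_321 \<sigma> t = (0, 0) \<longleftrightarrow> \<sigma> (Suc t) = Suc t"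
    using le fixed nonfixed fixed_iff unfolding letter_321_def state_321_def by fastforce
  show A: "lis (Suc t) \<sigma> = lis t \<sigma> + of_bool (fst (letter_321 \<sigma> t) \<or> fst (state_321 \<sigma> t) = 0)"
    unfolding l1 letter_321_def state_321_def by auto
  \<comment> \<open>The rule for the inverse asks for an excedance of the inverse,
    \<open>tstep\<close> only for a weak one. The two differ only at fixed points, where the
    crossing number 0 makes the other test true.\<close>
  have "lis (Suc t) (inv \<sigma>) = lis t (inv \<sigma>) +
      of_bool (\<not> inv \<sigma> (Suc t) < Suc t \<or> snd (state_321 \<sigma> t) = 0)"
  proof (cases "\<sigma> (Suc t) = Suc t")
    case True
    then show ?thesis using fixed[OF True] le fixed_iff unfolding l2 state_321_def by auto
  next
    case False
    then show ?thesis using fixed_iff unfolding l2 state_321_def by auto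
  qed
  then show "tstep (letter_321 \<sigma> t) (state_321 \<sigma> t) = state_321 \<sigma> (Suc t)"
    using A cs(1) by (auto simp: letter_321_def state_321_def split: if_splits)
qed

lemma word_321_suffix:
  assumes "t \<le> n"
  shows "taccept (map (letter_321 \<sigma>) [t..<n]) (state_321 \<sigma> t) \<and>
    tfp (map (letter_321 \<sigma>) [t..<n]) (state_321 \<sigma> t) = card {x \<in> {Suc t..n}. \<sigma> x = x} \<and>
    texc (map (letter_321 \<sigma>) [t..<n]) = card {x \<in> {Suc t..n}. x < \<sigma> x} \<and>
    tlis (map (letter_321 \<sigma>) [t..<n]) (state_321 \<sigma> t) + lis t \<sigma> = lis n \<sigma>"
  using assms
proof (induction t rule: inc_induct)
  case base
  note pi = permutes_inv[OF p] and ii = permutes_inv_inv[OF p]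
  have "crossing \<sigma> n = 0" unfolding crossing_alt(1)[OF p order_refl] by simp
  then have "state_321 \<sigma> n = (0, 0)"
    using lis_inv_le(1)[OF p order_refl] lis_inv_le(1)[OF pi order_refl]
      crossing_alt(2)[OF p order_refl] by (simp add: ii state_321_def)
  then show ?case by simp
next
  case (step t)
  note st = state_321_step[of t]
  have eq: "{x \<in> {Suc t..n}. Q x} = (if Q (Suc t) then insert (Suc t) {x \<in> {Suc (Suc t)..n}. Q x}
      else {x \<in> {Suc (Suc t)..n}. Q x})" for Q
    using step(2) by (auto simp: Suc_le_eq) (metis Suc_lessI)+
  have "card {x \<in> {Suc t..n}. Q x} = of_bool (Q (Suc t)) + card {x \<in> {Suc (Suc t)..n}. Q x}" for Q
    unfolding eq[of Q] by simp
  note cards = this[of "\<lambda>x. \<sigma> x = x"] this[of "\<lambda>x. x < \<sigma> x"]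
  have "[t..<n] = t # [Suc t..<n]" using step(2) by (simp add: upt_conv_Cons)
  then show ?case using step st cards by (simp add: letter_321_def)
qed

lemma word_321_correct:
  "taccept (word_321 n \<sigma>) (0, 0)" "tfp (word_321 n \<sigma>) (0, 0) = fp n \<sigma>"
  "texc (word_321 n \<sigma>) = exc n \<sigma>" "tlis (word_321 n \<sigma>) (0, 0) = lis n \<sigma>"
  using word_321_suffix[of 0] by (simp_all add: word_321_def fp_def exc_def state_321_def)

end

section \<open>Recovering 321-avoiders from words\<close>

lemma strict_mono_on_unique:
  fixes f g :: "nat \<Rightarrow> nat"
  assumes "finite A" "strict_mono_on A f" "strict_mono_on A g" "f ` A = g ` A" "x \<in> A"
  shows "f x = g x"
  using assms
proof (induction "card A" arbitrary: A x)
  case 0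
  then show ?case by simp
next
  case (Suc k)
  define m where "m = Max A"
  have m: "m \<in> A" "\<And>a. a \<in> A \<Longrightarrow> a \<le> m" using Suc by (auto simp: m_def intro!: Max_in)
  have top: "h m = Max (h ` A)" if "strict_mono_on A h" for h :: "nat \<Rightarrow> nat"
  proof (rule sym, rule Max_eqI)
    fix y assume "y \<in> h ` A"
    then obtain a where "a \<in> A" "y = h a" by blast
    then show "y \<le> h m" using that m by (cases "a = m") (auto simp: strict_mono_on_def order.strict_iff_order)
  qed (use Suc m in auto)
  have inj: "inj_on f A" "inj_on g A" using Suc.prems by (auto intro: strict_mono_on_imp_inj_on)
  have fm: "f m = g m" using top Suc.prems by metis
  have "f ` (A - {m}) = g ` (A - {m})"
    using inj_on_image_set_diff[OF inj(1), of A "{m}"] inj_on_image_set_diff[OF inj(2), of A "{m}"]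
      m(1) fm Suc.prems(4) by simp
  moreover have "strict_mono_on (A - {m}) f" "strict_mono_on (A - {m}) g"
    using Suc.prems monotone_on_subset by blast+
  ultimately have "f y = g y" if "y \<in> A - {m}" for y
    using Suc.hyps(1)[of "A - {m}" y] Suc.hyps(2) Suc.prems(1) m(1) that by simp
  then show ?case using fm Suc.prems(5) by blast
qed

lemma word_321_inj:
  assumes "\<sigma> permutes {1..n}" "avoids_321 n \<sigma>" "\<tau> permutes {1..n}" "avoids_321 n \<tau>"
    and eq: "word_321 n \<sigma> = word_321 n \<tau>"
  shows "\<sigma> = \<tau>"
proof -
  have "letter_321 \<sigma> t = letter_321 \<tau> t" if "t < n" for t
    using arg_cong[OF eq, of "\<lambda>xs. xs ! t"] that by (simp add: word_321_def)
  then have letter: "x < \<sigma> x \<longleftrightarrow> x < \<tau> x" "inv \<sigma> x < x \<longleftrightarrow> inv \<tau> x < x" if "x \<in> {1..n}" for x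
    using that by (cases x; force simp: letter_321_def)+
  define E where "E = {x \<in> {1..n}. x < \<sigma> x}"
  define F where "F = {v \<in> {1..n}. inv \<sigma> v < v}"
  have main: "strict_mono_on E \<rho>" "strict_mono_on ({1..n} - E) \<rho>" "\<rho> ` E = F" "\<rho> ` ({1..n} - E) = {1..n} - F"
    if r: "\<rho> permutes {1..n}" "avoids_321 n \<rho>" "E = {x \<in> {1..n}. x < \<rho> x}" "F = {v \<in> {1..n}. inv \<rho> v < v}" for \<rho>
  proof -
    note P = permutes_inv_facts[OF r(1)]
    show "strict_mono_on E \<rho>" unfolding strict_mono_on_def r(3)
      using weak_excedance_is_record[OF r(1,2)] by simp
    show "strict_mono_on ({1..n} - E) \<rho>" unfolding strict_mono_on_def r(3)
      using weak_deficiency_is_record[OF r(1,2)] by (simp add: not_less)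
    show E: "\<rho> ` E = F"
    proof (intro equalityI subsetI)
      fix v assume "v \<in> F"
      then have "inv \<rho> v \<in> E" using P(2)[of v] P(3)[of v] unfolding r(3,4) by simp
      then show "v \<in> \<rho> ` E" using P(3)[of v] image_eqI[of v \<rho> "inv \<rho> v"] by simp
    next
      fix v assume "v \<in> \<rho> ` E"
      then obtain x where "x \<in> E" "v = \<rho> x" by blast
      then show "v \<in> F" using P(1)[of x] P(4)[of x] unfolding r(3,4) by simp
    qed
    have "inj_on \<rho> {1..n}" using P(5) by (auto simp: inj_on_def)
    moreover have "E \<subseteq> {1..n}" by (auto simp: r(3))
    ultimately show "\<rho> ` ({1..n} - E) = {1..n} - F"
      using inj_on_image_set_diff[of \<rho> "{1..n}" "{1..n}" E] E permutes_image[OF r(1)] by simp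
  qed
  note s = main[OF assms(1,2) E_def F_def]
  have "E = {x \<in> {1..n}. x < \<tau> x}" "F = {v \<in> {1..n}. inv \<tau> v < v}"
    using letter unfolding E_def F_def by auto
  note t = main[OF assms(3,4) this]
  have "\<sigma> x = \<tau> x" for x
  proof (cases "x \<in> {1..n}")
    case True
    have "finite E" "finite ({1..n} - E)" by (simp_all add: E_def)
    then show ?thesis
      using strict_mono_on_unique[of E \<sigma> \<tau> x] strict_mono_on_unique[of "{1..n} - E" \<sigma> \<tau> x] s t True by auto
  next
    case False
    then show ?thesis using assms(1,3) by (simp add: permutes_def)
  qed
  then show ?thesis by blast
qed

text \<open>In the sum of the two components the growth of alpha and beta cancels and only 2 h
  remains. Acceptance thus yields a ballot condition on the letters alone, which suffices to build
  the permutation.\<close>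

lemma taccept_height:
  assumes "taccept cs w" "t \<le> length cs"
  defines "h \<equiv> fst w + snd w + 2 * (\<Sum>s<t. of_bool (fst (cs ! s)) - of_bool (snd (cs ! s)))"
  shows "0 \<le> h \<and> (t < length cs \<and> snd (cs ! t) \<longrightarrow> 0 < h) \<and> (t = length cs \<longrightarrow> h = 0)"
  using assms(1,2) unfolding h_def
proof (induction cs arbitrary: w t)
  case Nil
  then show ?case by simp
next
  case (Cons c cs)
  obtain p q y z where cw: "c = (p, q)" "w = (y, z)" by force
  show ?case
  proof (cases t)
    case 0
    then show ?thesis using Cons.prems by (auto simp: cw)
  next
    case (Suc t')
    have "taccept cs (tstep c w)" "t' \<le> length cs" using Cons.prems Suc by (auto simp del: tstep.simps)
    note IH = Cons.IH[OF this]
    have "fst (tstep c w) + snd (tstep c w) = y + z + 2 * (of_bool p - of_bool q)"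
      by (simp add: cw)
    then show ?thesis using IH unfolding Suc sum.lessThan_Suc_shift by (simp add: cw algebra_simps)
  qed
qed

lemma card_conv_sum_of_bool: "int (card {x \<in> {1..t}. Q x}) = (\<Sum>s<t. of_bool (Q (Suc s)))"
proof (induction t)
  case (Suc t)
  have "{x \<in> {1..Suc t}. Q x} = (if Q (Suc t) then insert (Suc t) {x \<in> {1..t}. Q x} else {x \<in> {1..t}. Q x})"
    by (auto simp: le_Suc_eq)
  then show ?case using Suc by simp
qed simp

lemma ex_strict_mono_bij_betw:
  fixes E F :: "nat set"
  assumes "finite E" "finite F" "card E = card F"
  obtains f where "bij_betw f E F" "strict_mono_on E f"
proof -
  obtain h where h: "bij_betw h {..<card E} E" "strict_mono_on {..<card E} h"
    using ex_bij_betw_strict_mono_card[OF assms(1)] by blast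
  obtain h' where h': "bij_betw h' {..<card F} F" "strict_mono_on {..<card F} h'"
    using ex_bij_betw_strict_mono_card[OF assms(2)] by blast
  define e where "e = inv_into {..<card E} h"
  have e: "bij_betw e E {..<card E}" unfolding e_def by (rule bij_betw_inv_into[OF h(1)])
  have he: "h (e x) = x" if "x \<in> E" for x
    using bij_betw_inv_into_right[OF h(1) that] by (simp add: e_def)
  have em: "e x \<in> {..<card E}" if "x \<in> E" for x using e that by (auto simp: bij_betw_def)
  have e_mono: "e x < e y" if "x \<in> E" "y \<in> E" "x < y" for x y
    using strict_mono_on_less[OF h(2) em em, of x y] he that by simp
  have "bij_betw (h' \<circ> e) E F" using e h'(1) assms(3) by (auto intro: bij_betw_trans)
  moreover have "strict_mono_on E (h' \<circ> e)"
    using e_mono em h'(2) assms(3) by (auto simp: strict_mono_on_def)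
  ultimately show ?thesis using that by blast
qed

lemma card_less_strict_mono_bij:
  fixes f :: "nat \<Rightarrow> nat"
  assumes "bij_betw f A B" "strict_mono_on A f" "x \<in> A"
  shows "card {b \<in> B. b < f x} = card {a \<in> A. a < x}"
proof -
  have mono: "f a < f x \<longleftrightarrow> a < x" if "a \<in> A" for a
    using strict_mono_on_less[OF assms(2) that assms(3)] .
  have "{b \<in> B. b < f x} = f ` {a \<in> A. a < x}"
    using mono assms(1) unfolding bij_betw_def by auto
  then show ?thesis
    using assms(1) by (auto simp: bij_betw_def intro!: card_image elim: inj_on_subset)
qed

lemma strict_mono_union_avoids_321:
  assumes "strict_mono_on E \<sigma>" "strict_mono_on ({1..n} - E) \<sigma>"
  shows "avoids_321 n \<sigma>"
  unfolding avoids_321_def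
proof (intro allI impI)
  fix x y z :: nat
  assume *: "1 \<le> x" "x < y" "y < z" "z \<le> n" "\<sigma> z < \<sigma> y" "\<sigma> y < \<sigma> x"
  then have "x \<in> {1..n}" "y \<in> {1..n}" "z \<in> {1..n}" by auto
  moreover have "\<sigma> u < \<sigma> v" if "u < v" "u \<in> {1..n}" "v \<in> {1..n}" "u \<in> E \<longleftrightarrow> v \<in> E" for u v
    using assms that unfolding strict_mono_on_def by blast
  note this[of x y] this[of y z] this[of x z]
  ultimately show False using * by (cases "x \<in> E"; cases "y \<in> E"; cases "z \<in> E"; simp)
qed

lemma word_321_surj:
  assumes acc: "taccept cs (0, 0)" and len: "length cs = n"
  shows "\<exists>\<sigma>. \<sigma> permutes {1..n} \<and> avoids_321 n \<sigma> \<and> word_321 n \<sigma> = cs"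
proof -
  define E where "E = {x \<in> {1..n}. fst (cs ! (x - 1))}"
  define F where "F = {x \<in> {1..n}. snd (cs ! (x - 1))}"
  let ?E' = "{1..n} - E" and ?F' = "{1..n} - F"
  have fin: "finite E" "finite F" and sub: "E \<subseteq> {1..n}" "F \<subseteq> {1..n}" by (auto simp: E_def F_def)
  have sum: "(\<Sum>s<t. of_bool (fst (cs ! s)) - of_bool (snd (cs ! s))) =
      int (card {x \<in> E. x \<le> t}) - int (card {x \<in> F. x \<le> t})" if "t \<le> n" for t
  proof -
    have "{x \<in> E. x \<le> t} = {x \<in> {1..t}. fst (cs ! (x - 1))}" "{x \<in> F. x \<le> t} = {x \<in> {1..t}. snd (cs ! (x - 1))}"
      using that by (auto simp: E_def F_def)
    then show ?thesis by (simp only: card_conv_sum_of_bool) (simp add: sum_subtractf)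
  qed
  have le: "card {x \<in> F. x \<le> t} \<le> card {x \<in> E. x \<le> t}" if "t \<le> n" for t
    using taccept_height[OF acc, of t] sum[OF that] that len by simp
  have less: "card {x \<in> F. x < v} < card {x \<in> E. x < v}" if "v \<in> F" for v
  proof -
    obtain t where t: "v = Suc t" using \<open>v \<in> F\<close> unfolding F_def by (cases v) auto
    then show ?thesis
      using taccept_height[OF acc, of t] sum[of t] that len by (simp add: F_def less_Suc_eq_le)
  qed
  have "{x \<in> E. x \<le> n} = E" "{x \<in> F. x \<le> n} = F" using sub by auto
  then have card: "card E = card F"
    using taccept_height[OF acc, of n] sum[of n] len by simp
  then have card': "card ?E' = card ?F'" using sub fin by (simp add: card_Diff_subset)
  obtain f where f: "bij_betw f E F" "strict_mono_on E f"
    by (rule ex_strict_mono_bij_betw[OF fin card])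
  obtain g where g: "bij_betw g ?E' ?F'" "strict_mono_on ?E' g"
    by (rule ex_strict_mono_bij_betw[OF _ _ card']) auto
  \<comment> \<open>There are as many elements of \<open>F\<close> below \<open>f x\<close> as of
    \<open>E\<close> below \<open>x\<close>. If \<open>f x\<close> were at most \<open>x\<close>,
    this would be no fewer than the elements of \<open>E\<close> below \<open>f x\<close>, against
    \<open>less\<close>.\<close>
  have exc: "x < f x" if "x \<in> E" for x
  proof (rule ccontr)
    assume "\<not> x < f x"
    have "f x \<in> F" using f(1) that by (auto simp: bij_betw_def)
    from less[OF this] have "card {a \<in> E. a < x} < card {a \<in> E. a < f x}"
      using card_less_strict_mono_bij[OF f that] by simp
    moreover have "card {a \<in> E. a < f x} \<le> card {a \<in> E. a < x}"
      using \<open>\<not> x < f x\<close> fin by (intro card_mono) auto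
    ultimately show False by simp
  qed
  \<comment> \<open>The same count for the complements: by \<open>co\<close> the inequality
    \<open>le\<close> is reversed there, and it fails at \<open>x\<close> if
    \<open>x < g x\<close>.\<close>
  have nonexc: "g x \<le> x" if "x \<in> ?E'" for x
  proof (rule ccontr)
    assume "\<not> g x \<le> x"
    have co: "card {a \<in> {1..n} - S. a \<le> x} + card {a \<in> S. a \<le> x} = x" if "S \<subseteq> {1..n}" for S
    proof -
      have "{a \<in> {1..n} - S. a \<le> x} \<union> {a \<in> S. a \<le> x} = {1..x}" using that \<open>x \<in> ?E'\<close> by auto
      moreover have "card ({a \<in> {1..n} - S. a \<le> x} \<union> {a \<in> S. a \<le> x})
          = card {a \<in> {1..n} - S. a \<le> x} + card {a \<in> S. a \<le> x}"
        using finite_subset[OF that] by (intro card_Un_disjoint) auto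
      ultimately show ?thesis by simp
    qed
    have "{a \<in> ?E'. a \<le> x} = insert x {a \<in> ?E'. a < x}" using that by auto
    then have "card {a \<in> ?E'. a \<le> x} = Suc (card {a \<in> ?E'. a < x})" by simp
    then have "card {a \<in> ?E'. a \<le> x} = Suc (card {b \<in> ?F'. b < g x})"
      using card_less_strict_mono_bij[OF g that] by simp
    moreover have "card {b \<in> ?F'. b \<le> x} \<le> card {b \<in> ?F'. b < g x}"
      using \<open>\<not> g x \<le> x\<close> by (intro card_mono) auto
    moreover have "x \<le> n" using that by simp
    ultimately show False using co[OF sub(1)] co[OF sub(2)] le[of x] by linarith
  qed
  define \<sigma> where "\<sigma> x = (if x \<in> E then f x else if x \<in> {1..n} then g x else x)" for x
  have "bij_betw \<sigma> E F" using f(1) by (rule bij_betw_cong[THEN iffD1, rotated]) (simp add: \<sigma>_def)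
  moreover have "bij_betw \<sigma> ?E' ?F'" using g(1) by (rule bij_betw_cong[THEN iffD1, rotated]) (simp add: \<sigma>_def)
  ultimately have "bij_betw \<sigma> (E \<union> ?E') (F \<union> ?F')" by (rule bij_betw_combine) auto
  then have "bij_betw \<sigma> {1..n} {1..n}" using sub by (simp add: Un_absorb1)
  then have p: "\<sigma> permutes {1..n}" using sub by (intro bij_imp_permutes) (auto simp: \<sigma>_def)
  have mono: "strict_mono_on E \<sigma>" "strict_mono_on ?E' \<sigma>"
    using f(2) g(2) by (auto simp: strict_mono_on_def \<sigma>_def)
  have iE: "x < \<sigma> x \<longleftrightarrow> x \<in> E" if "x \<in> {1..n}" for x
    using exc[of x] nonexc[of x] that by (auto simp: \<sigma>_def)
  have iF: "inv \<sigma> v < v \<longleftrightarrow> v \<in> F" if "v \<in> {1..n}" for v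
  proof (cases "v \<in> F")
    case True
    then obtain x where "x \<in> E" "v = f x" using f(1) by (auto simp: bij_betw_def)
    then show ?thesis using True exc[of x] permutes_inv_facts(4)[OF p, of x] by (simp add: \<sigma>_def)
  next
    case False
    then have "v \<in> ?F'" using that by simp
    then obtain x where "x \<in> ?E'" "v = g x" using g(1) unfolding bij_betw_def by blast
    then show ?thesis using False nonexc[of x] permutes_inv_facts(4)[OF p, of x] by (simp add: \<sigma>_def)
  qed
  have "word_321 n \<sigma> = cs"
  proof (rule nth_equalityI)
    fix s assume "s < length (word_321 n \<sigma>)"
    then have "s < n" by (simp add: word_321_def)
    then show "word_321 n \<sigma> ! s = cs ! s"
      using iE[of "Suc s"] iF[of "Suc s"]
      by (simp add: word_321_def letter_321_def E_def F_def prod_eq_iff)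
  qed (simp add: word_321_def len)
  then show ?thesis using p strict_mono_union_avoids_321[OF mono] by blast
qed

lemma bij_betw_word_321:
  "bij_betw (word_321 n)
     {\<sigma>. \<sigma> permutes {1..n} \<and> avoids_321 n \<sigma> \<and> fp n \<sigma> = i \<and> exc n \<sigma> = j \<and> lis n \<sigma> = k}
     {cs. length cs = n \<and> taccept cs (0, 0) \<and> tfp cs (0, 0) = i \<and> texc cs = j \<and> tlis cs (0, 0) = k}"
  unfolding bij_betw_def
proof (intro conjI inj_onI equalityI subsetI)
  fix \<sigma> \<tau>
  assume "\<sigma> \<in> {\<sigma>. \<sigma> permutes {1..n} \<and> avoids_321 n \<sigma> \<and> fp n \<sigma> = i \<and> exc n \<sigma> = j \<and> lis n \<sigma> = k}"
    "\<tau> \<in> {\<sigma>. \<sigma> permutes {1..n} \<and> avoids_321 n \<sigma> \<and> fp n \<sigma> = i \<and> exc n \<sigma> = j \<and> lis n \<sigma> = k}"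
    "word_321 n \<sigma> = word_321 n \<tau>"
  then show "\<sigma> = \<tau>" using word_321_inj by blast
next
  fix cs assume "cs \<in> word_321 n ` {\<sigma>. \<sigma> permutes {1..n} \<and> avoids_321 n \<sigma> \<and> fp n \<sigma> = i \<and> exc n \<sigma> = j \<and> lis n \<sigma> = k}"
  then show "cs \<in> {cs. length cs = n \<and> taccept cs (0, 0) \<and> tfp cs (0, 0) = i \<and> texc cs = j \<and> tlis cs (0, 0) = k}"
    by (auto simp: word_321_correct) (simp add: word_321_def)
next
  fix cs assume cs: "cs \<in> {cs. length cs = n \<and> taccept cs (0, 0) \<and> tfp cs (0, 0) = i \<and> texc cs = j \<and> tlis cs (0, 0) = k}"
  then obtain \<sigma> where "\<sigma> permutes {1..n}" "avoids_321 n \<sigma>" "word_321 n \<sigma> = cs"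
    using word_321_surj by blast
  then show "cs \<in> word_321 n ` {\<sigma>. \<sigma> permutes {1..n} \<and> avoids_321 n \<sigma> \<and> fp n \<sigma> = i \<and> exc n \<sigma> = j \<and> lis n \<sigma> = k}"
    using cs word_321_correct[of \<sigma> n] by (intro image_eqI[of _ _ \<sigma>]) auto
qed

section \<open>132-avoiding permutations\<close>

definition prefix_min :: "(nat \<Rightarrow> nat) \<Rightarrow> nat \<Rightarrow> nat" where
  "prefix_min \<sigma> i = Min (\<sigma> ` {1..i})"

lemma prefix_min_le: "1 \<le> x \<Longrightarrow> x \<le> i \<Longrightarrow> prefix_min \<sigma> i \<le> \<sigma> x"
  by (simp add: prefix_min_def)

lemma prefix_min_attained:
  assumes "1 \<le> i"
  obtains x where "1 \<le> x" "x \<le> i" "prefix_min \<sigma> i = \<sigma> x"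
proof -
  have "Min (\<sigma> ` {1..i}) \<in> \<sigma> ` {1..i}" using assms by (intro Min_in) auto
  then show ?thesis using that by (auto simp: prefix_min_def)
qed

lemma prefix_min_le_iff: "1 \<le> i \<Longrightarrow> prefix_min \<sigma> i \<le> k \<longleftrightarrow> (\<exists>x. 1 \<le> x \<and> x \<le> i \<and> \<sigma> x \<le> k)"
  by (metis prefix_min_attained prefix_min_le order.trans)

lemma prefix_min_antimono: "1 \<le> i \<Longrightarrow> i \<le> j \<Longrightarrow> prefix_min \<sigma> j \<le> prefix_min \<sigma> i"
  by (metis prefix_min_attained prefix_min_le order.trans)

lemma upward_closed_eq_interval:
  assumes sub: "I \<subseteq> {1..d}" and up: "\<And>i j. i \<in> I \<Longrightarrow> i \<le> j \<Longrightarrow> j \<le> d \<Longrightarrow> j \<in> I"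
  shows "I = {Suc (d - card I)..d}"
proof (cases "I = {}")
  case False
  have fin: "finite I" using sub finite_subset by blast
  define m where "m = Min I"
  have m: "m \<in> I" "\<And>i. i \<in> I \<Longrightarrow> m \<le> i" unfolding m_def using Min_in[OF fin False] Min_le[OF fin] by auto
  have "I = {m..d}"
  proof (intro equalityI subsetI)
    fix i assume "i \<in> I"
    then show "i \<in> {m..d}" using m(2) sub by auto
  next
    fix i assume "i \<in> {m..d}"
    then show "i \<in> I" using up[OF m(1)] by simp
  qed
  moreover have "1 \<le> m" "m \<le> d" using m(1) sub by auto
  moreover from calculation have "Suc (d - card I) = m" by simp
  ultimately show ?thesis by simp
qed simp

text \<open>The subtraction never truncates where it is used: with rank at least \<open>d\<close>,
  the minimum exceeds \<open>d\<close> and hence \<open>i\<close>.\<close>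

definition min_times :: "(nat \<Rightarrow> nat) \<Rightarrow> nat \<Rightarrow> nat set" where
  "min_times \<sigma> d = (\<lambda>i. prefix_min \<sigma> i - i) ` {1..d}"

text \<open>Time n comes first, since \<open>refl_walk\<close> expects the last step at the
  head.\<close>

definition time_word :: "nat \<Rightarrow> nat set \<Rightarrow> bool list" where
  "time_word n D = map (\<lambda>t. t \<in> D) (rev [1..<Suc n])"

lemma time_word_simps [simp]:
  "time_word 0 D = []" "time_word (Suc n) D = (Suc n \<in> D) # time_word n D"
  by (simp_all add: time_word_def)

lemma avoids_132_inv:
  assumes p: "\<sigma> permutes {1..n}" and "avoids_132 n \<sigma>"
  shows "avoids_132 n (inv \<sigma>)"
  unfolding avoids_132_def
proof (intro allI impI)
  fix x y z :: nat
  assume *: "1 \<le> x" "x < y" "y < z" "z \<le> n" "inv \<sigma> x < inv \<sigma> z" "inv \<sigma> z < inv \<sigma> y"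
  note P = permutes_inv_facts[OF p]
  have "1 \<le> inv \<sigma> x" "inv \<sigma> y \<le> n" using * P(2)[of x] P(2)[of y] by auto
  moreover have "\<sigma> (inv \<sigma> x) < \<sigma> (inv \<sigma> y)" "\<sigma> (inv \<sigma> y) < \<sigma> (inv \<sigma> z)"
    unfolding P(3) using * by auto
  ultimately show False
    using assms(2) *(5,6) unfolding avoids_132_def by blast
qed

text \<open>The rank condition says that the square of the first \<open>d\<close> positions and
  values contains no point of the permutation, which is symmetric under inversion. All results of
  the locale are therefore available for the inverse too.\<close>

locale ranked_132 =
  fixes \<sigma> :: "nat \<Rightarrow> nat" and n d :: nat
  assumes p: "\<sigma> permutes {1..n}" and av: "avoids_132 n \<sigma>" and dn: "d \<le> n"
    and rank: "\<And>i. 1 \<le> i \<Longrightarrow> i \<le> d \<Longrightarrow> d < \<sigma> i"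
begin

lemmas P = permutes_inv_facts[OF p]

abbreviation "D \<equiv> min_times \<sigma> d"
definition "downs t = card {s \<in> {1..t}. s \<in> D}"
definition "ups t = card {s \<in> {1..t}. s \<notin> D}"
definition "low v = card {i \<in> {1..d}. \<sigma> i \<le> v}"

lemma ranked_132_inv: "ranked_132 (inv \<sigma>) n d"
proof
  show "d < inv \<sigma> i" if "1 \<le> i" "i \<le> d" for i
    using rank[of "inv \<sigma> i"] P(2)[of i] P(3)[of i] that dn by fastforce
qed (use permutes_inv[OF p] avoids_132_inv[OF p av] dn in auto)

lemma rank_prefix_min: "1 \<le> i \<Longrightarrow> i \<le> d \<Longrightarrow> d < prefix_min \<sigma> i"
  by (metis prefix_min_attained rank order.trans)

lemma prefix_min_le_n: "1 \<le> i \<Longrightarrow> i \<le> n \<Longrightarrow> prefix_min \<sigma> i \<le> n"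
  using prefix_min_le[of 1 i \<sigma>] P(1)[of 1] by simp

lemma min_time_strict: "1 \<le> i \<Longrightarrow> i < j \<Longrightarrow> j \<le> d \<Longrightarrow> prefix_min \<sigma> j - j < prefix_min \<sigma> i - i"
  using prefix_min_antimono[of i j \<sigma>] rank_prefix_min[of i] rank_prefix_min[of j] by linarith

lemma inj_on_min_time: "inj_on (\<lambda>i. prefix_min \<sigma> i - i) {1..d}"
  by (rule linorder_inj_onI) (use min_time_strict in \<open>force+\<close>)

lemma min_times_sub: "D \<subseteq> {1..n}"
proof
  fix t assume "t \<in> D"
  then obtain i where i: "1 \<le> i" "i \<le> d" "t = prefix_min \<sigma> i - i" by (auto simp: min_times_def)
  have "i < prefix_min \<sigma> i" "prefix_min \<sigma> i \<le> n"
    using rank_prefix_min[of i] prefix_min_le_n[of i] i dn by linarith+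
  then show "t \<in> {1..n}" unfolding i(3) atLeastAtMost_iff by arith
qed

lemma card_min_times: "card D = d"
  unfolding min_times_def by (subst card_image[OF inj_on_min_time]) simp

lemma downs_ups: "downs t + ups t = t"
proof -
  have "{s \<in> {1..t}. s \<in> D} \<union> {s \<in> {1..t}. s \<notin> D} = {1..t}" by auto
  moreover have "card ({s \<in> {1..t}. s \<in> D} \<union> {s \<in> {1..t}. s \<notin> D}) = downs t + ups t"
    unfolding downs_def ups_def by (rule card_Un_disjoint) auto
  ultimately show ?thesis by simp
qed

lemma downs_Suc: "downs (Suc t) = downs t + of_bool (Suc t \<in> D)"
proof -
  have "{s \<in> {1..Suc t}. s \<in> D} = (if Suc t \<in> D then insert (Suc t) {s \<in> {1..t}. s \<in> D} else {s \<in> {1..t}. s \<in> D})"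
    by (auto simp: le_Suc_eq)
  then show ?thesis by (simp add: downs_def)
qed

lemma ups_Suc: "ups (Suc t) = ups t + of_bool (Suc t \<notin> D)"
  using downs_Suc[of t] downs_ups[of t] downs_ups[of "Suc t"] by auto

lemma downs_n: "downs n = d" and ups_n: "ups n = n - d"
proof -
  have "{s \<in> {1..n}. s \<in> D} = D" using min_times_sub by auto
  then show "downs n = d" by (simp add: downs_def card_min_times)
  then show "ups n = n - d" using downs_ups[of n] by simp
qed

lemma ups_mono: "s \<le> t \<Longrightarrow> ups s \<le> ups t"
  unfolding ups_def by (intro card_mono) auto

lemma ups_less:
  assumes "t < n" "Suc t \<notin> D"
  shows "d + ups t + 1 \<le> n"
  using ups_mono[of "Suc t" n] assms ups_Suc[of t] ups_n dn by simp

text \<open>The times \<open>prefix_min \<sigma> i - i\<close> fall strictly as \<open>i\<close>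
  grows, so the indices whose time has passed form a final segment of \<open>{1..d}\<close>.\<close>

lemma downs_eq: "downs t = card {i \<in> {1..d}. prefix_min \<sigma> i - i \<le> t}"
  and passed_eq: "{i \<in> {1..d}. prefix_min \<sigma> i - i \<le> t} = {Suc (d - downs t)..d}"
proof -
  let ?I = "{i \<in> {1..d}. prefix_min \<sigma> i - i \<le> t}"
  have "{s \<in> {1..t}. s \<in> D} = {s \<in> D. s \<le> t}" using min_times_sub by auto
  also have "\<dots> = (\<lambda>i. prefix_min \<sigma> i - i) ` ?I" unfolding min_times_def by auto
  finally have "{s \<in> {1..t}. s \<in> D} = (\<lambda>i. prefix_min \<sigma> i - i) ` ?I" .
  then show c: "downs t = card ?I"
    unfolding downs_def by (simp only:) (rule card_image[OF inj_on_subset[OF inj_on_min_time]], blast)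
  have "?I = {Suc (d - card ?I)..d}"
  proof (rule upward_closed_eq_interval)
    fix i j assume "i \<in> ?I" "i \<le> j" "j \<le> d"
    then show "j \<in> ?I" using min_time_strict[of i j] by (cases "i = j") auto
  qed auto
  then show "?I = {Suc (d - downs t)..d}" using c by simp
qed

lemma downs_le_d: "downs t \<le> d"
proof -
  have "downs t \<le> card {1..d}" unfolding downs_eq by (intro card_mono) auto
  then show ?thesis by simp
qed

text \<open>The largest minimum among passed indices belongs to the first of them,
  \<open>d - downs t + 1\<close>. It is at most \<open>t\<close> plus this index, which is
  \<open>d + ups t + 1\<close> because \<open>t = downs t + ups t\<close>.\<close>

lemma passed_sub: "{i \<in> {1..d}. prefix_min \<sigma> i - i \<le> t} \<subseteq> {i \<in> {1..d}. prefix_min \<sigma> i \<le> d + ups t + 1}"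
proof
  fix i assume i: "i \<in> {i \<in> {1..d}. prefix_min \<sigma> i - i \<le> t}"
  define i1 where "i1 = Suc (d - downs t)"
  have "i1 \<in> {i \<in> {1..d}. prefix_min \<sigma> i - i \<le> t}" "i1 \<le> i"
    using i unfolding passed_eq i1_def by auto
  then have "prefix_min \<sigma> i \<le> prefix_min \<sigma> i1" "prefix_min \<sigma> i1 \<le> t + i1"
    using prefix_min_antimono[of i1 i \<sigma>] by auto
  then show "i \<in> {i \<in> {1..d}. prefix_min \<sigma> i \<le> d + ups t + 1}"
    using i downs_ups[of t] downs_le_d[of t] by (simp add: i1_def)
qed

lemma downs_le: "downs t \<le> card {i \<in> {1..d}. prefix_min \<sigma> i \<le> d + ups t + 1}"
  unfolding downs_eq using passed_sub[of t] by (intro card_mono) auto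

text \<open>The last index not yet passed, \<open>d - downs t\<close>, has a time beyond
  \<open>t\<close>, and the up step excludes \<open>t + 1\<close>. A time of at least
  \<open>t + 2\<close> puts its minimum above \<open>d + ups t + 1\<close>, and the minima of
  smaller indices are no smaller.\<close>

lemma downs_eq_up:
  assumes "Suc t \<notin> D"
  shows "downs t = card {i \<in> {1..d}. prefix_min \<sigma> i \<le> d + ups t + 1}"
proof -
  have "{i \<in> {1..d}. prefix_min \<sigma> i \<le> d + ups t + 1} \<subseteq> {i \<in> {1..d}. prefix_min \<sigma> i - i \<le> t}"
  proof (rule subsetI, rule ccontr)
    fix i assume i: "i \<in> {i \<in> {1..d}. prefix_min \<sigma> i \<le> d + ups t + 1}"
      and "i \<notin> {i \<in> {1..d}. prefix_min \<sigma> i - i \<le> t}"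
    define i0 where "i0 = d - downs t"
    have "i \<notin> {Suc (d - downs t)..d}"
      using \<open>i \<notin> {i \<in> {1..d}. prefix_min \<sigma> i - i \<le> t}\<close> unfolding passed_eq .
    then have i0: "1 \<le> i0" "i \<le> i0" "i0 \<le> d" using i by (auto simp: i0_def)
    then have "i0 \<notin> {i \<in> {1..d}. prefix_min \<sigma> i - i \<le> t}" unfolding passed_eq by (simp add: i0_def)
    then have "t < prefix_min \<sigma> i0 - i0" using i0 by simp
    moreover have "prefix_min \<sigma> i0 - i0 \<in> D" using i0 by (simp add: min_times_def)
    then have "prefix_min \<sigma> i0 - i0 \<noteq> Suc t" using assms by metis
    moreover have "prefix_min \<sigma> i0 \<le> prefix_min \<sigma> i" using prefix_min_antimono[of i i0 \<sigma>] i0 i by simp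
    ultimately have "prefix_min \<sigma> i \<ge> Suc (Suc (t + i0))" by arith
    moreover have "i0 + downs t = d" using downs_le_d[of t] by (simp add: i0_def)
    moreover have "prefix_min \<sigma> i \<le> d + ups t + 1" using i by simp
    ultimately show False using downs_ups[of t] by linarith
  qed
  then show ?thesis unfolding downs_eq using passed_sub[of t] by (metis (no_types, lifting) subset_antisym)
qed

text \<open>If a minimum at most \<open>v\<close> were attained before \<open>i\<close> while
  \<open>\<sigma> i\<close> exceeds \<open>v\<close>, then that minimum, \<open>\<sigma> i\<close>
  and the later entry \<open>v\<close> would form the pattern 132.\<close>

lemma not_low_iff:
  assumes "d < v" "v \<le> n" "inv \<sigma> v > d" "1 \<le> i" "i \<le> d"
  shows "prefix_min \<sigma> i \<le> v \<longleftrightarrow> \<sigma> i < v"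
proof
  assume le: "prefix_min \<sigma> i \<le> v"
  obtain j where j: "1 \<le> j" "j \<le> i" "prefix_min \<sigma> i = \<sigma> j" using prefix_min_attained[OF assms(4)] .
  have ne: "\<sigma> x \<noteq> v" if "x \<le> d" for x using P(4)[of x] that assms(3) by auto
  have "inv \<sigma> v \<le> n" using P(2)[of v] assms(1,2) by simp
  show "\<sigma> i < v"
  proof (rule ccontr)
    assume "\<not> \<sigma> i < v"
    then have "\<sigma> j < v" "v < \<sigma> i" using le j ne[of i] ne[of j] assms(5) by auto
    moreover from this have "j < i" using j(2) by (cases "j = i") auto
    ultimately show False
      using av j(1) assms(3,5) \<open>inv \<sigma> v \<le> n\<close> P(3)[of v] unfolding avoids_132_def
      by (metis le_less_trans)
  qed
qed (use prefix_min_le[of i i \<sigma>] assms in simp)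

lemma low_Suc: "low (Suc v) = low v + of_bool (1 \<le> inv \<sigma> (Suc v) \<and> inv \<sigma> (Suc v) \<le> d)"
proof -
  let ?i = "inv \<sigma> (Suc v)"
  have "\<sigma> i \<le> Suc v \<longleftrightarrow> \<sigma> i \<le> v \<or> i = ?i" for i using P(3)[of "Suc v"] P(4)[of i] by (auto simp: le_Suc_eq)
  then have "{i \<in> {1..d}. \<sigma> i \<le> Suc v} = (if 1 \<le> ?i \<and> ?i \<le> d then insert ?i {i \<in> {1..d}. \<sigma> i \<le> v} else {i \<in> {1..d}. \<sigma> i \<le> v})"
    by auto
  moreover have "?i \<notin> {i \<in> {1..d}. \<sigma> i \<le> v}" using P(3)[of "Suc v"] by simp
  ultimately show ?thesis by (auto simp: low_def)
qed

text \<open>At an up step \<open>downs t\<close> counts the prefix minima up to \<open>v\<close>, so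
  it bounds \<open>low v\<close>. If \<open>v\<close> lies in the first \<open>d\<close> positions,
  \<open>low\<close> is about to grow and was strictly smaller; if not, \<open>not_low_iff\<close>
  turns the bound into an equality.\<close>

lemma up_step:
  assumes "t < n" "Suc t \<notin> D"
  defines "v \<equiv> Suc (d + ups t)"
  shows "low (d + ups t) \<le> downs t" "low (d + ups t) < downs t \<longleftrightarrow> inv \<sigma> v \<le> d"
    "low v = low (d + ups t) + of_bool (inv \<sigma> v \<le> d)"
proof -
  have vn: "v \<le> n" "d < v" using ups_less[OF assms(1,2)] by (auto simp: v_def)
  have i1: "1 \<le> inv \<sigma> v" using P(2)[of v] vn by simp
  then show low: "low v = low (d + ups t) + of_bool (inv \<sigma> v \<le> d)" unfolding v_def using low_Suc by auto
  have dv: "downs t = card {i \<in> {1..d}. prefix_min \<sigma> i \<le> v}"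
    using downs_eq_up[OF assms(2)] by (simp add: v_def)
  have le: "low v \<le> downs t"
    unfolding dv low_def using prefix_min_le[of _ _ \<sigma>] by (intro card_mono) (auto intro: order.trans)
  show "low (d + ups t) \<le> downs t" using low le by simp
  show "low (d + ups t) < downs t \<longleftrightarrow> inv \<sigma> v \<le> d"
  proof (cases "inv \<sigma> v \<le> d")
    case True then show ?thesis using low le by simp
  next
    case False
    have "{i \<in> {1..d}. prefix_min \<sigma> i \<le> v} = {i \<in> {1..d}. \<sigma> i \<le> d + ups t}"
      using not_low_iff[OF vn(2,1)] False by (auto simp: v_def less_Suc_eq_le)
    then show ?thesis using False unfolding dv low_def by simp
  qed
qed

lemma refl_walk_time_word:
  "t \<le> n \<Longrightarrow> refl_walk (time_word t D) =
     (int (downs t) - int (low (d + ups t)), int (ups t) - int (low (d + ups t)))"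
proof (induction t)
  case 0
  have "{i \<in> {1..d}. \<sigma> i \<le> d} = {}" using rank by force
  then show ?case by (simp add: downs_def ups_def low_def)
next
  case (Suc t)
  then have IH: "refl_walk (time_word t D) =
     (int (downs t) - int (low (d + ups t)), int (ups t) - int (low (d + ups t)))" by simp
  show ?case
  proof (cases "Suc t \<in> D")
    case True
    then show ?thesis using IH by (simp add: downs_Suc ups_Suc)
  next
    case False
    then show ?thesis using IH up_step[of t] Suc.prems by (auto simp: downs_Suc ups_Suc)
  qed
qed

text \<open>The end state depends only on \<open>n\<close> and \<open>d\<close>, so the walks of a
  permutation and of its inverse end alike.\<close>

lemma refl_walk_time_word_n: "refl_walk (time_word n D) = (0, int n - 2 * int d)"
proof -
  have "\<sigma> i \<le> n" if "1 \<le> i" "i \<le> d" for i using P(1)[of i] that dn by simp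
  then have "{i \<in> {1..d}. \<sigma> i \<le> n} = {1..d}" by auto
  then have "low n = d" by (simp add: low_def)
  then show ?thesis using refl_walk_time_word[of n] dn by (simp add: downs_n ups_n)
qed

end

definition pair_word :: "nat \<Rightarrow> nat set \<Rightarrow> nat set \<Rightarrow> (bool \<times> bool) list" where
  "pair_word n A B = map (\<lambda>t. (t \<in> A, t \<in> B)) (rev [1..<Suc n])"

lemma pair_word_simps [simp]:
  "pair_word 0 A B = []" "pair_word (Suc n) A B = (Suc n \<in> A, Suc n \<in> B) # pair_word n A B"
  by (simp_all add: pair_word_def)

lemma map_pair_word [simp]:
  "map fst (pair_word n A B) = time_word n A" "map snd (pair_word n A B) = time_word n B"
  by (simp_all add: pair_word_def time_word_def)

lemma length_pair_word [simp]: "length (pair_word n A B) = n"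
  by (simp add: pair_word_def)

section \<open>Entries beyond the rank, excedances and fixed points\<close>

context ranked_132
begin

lemma low_le_downs: "t \<le> n \<Longrightarrow> low (d + ups t) \<le> downs t"
  using refl_walk_invar[OF refl_walk_time_word[of t]] by simp

lemma low_mono: "v \<le> v' \<Longrightarrow> low v \<le> low v'"
  unfolding low_def by (intro card_mono) auto

lemma card_interval_Suc:
  "card {v \<in> {Suc d..Suc (d + q)}. Q v} = card {v \<in> {Suc d..d + q}. Q v} + of_bool (Q (Suc (d + q)))"
proof -
  have "{v \<in> {Suc d..Suc (d + q)}. Q v} = (if Q (Suc (d + q)) then insert (Suc (d + q)) {v \<in> {Suc d..d + q}. Q v}
      else {v \<in> {Suc d..d + q}. Q v})" by (auto simp: le_Suc_eq)
  then show ?thesis by simp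
qed

lemma card_high_plus_low: "d + q \<le> n \<Longrightarrow> card {v \<in> {Suc d..d + q}. d < inv \<sigma> v} + low (d + q) = q"
proof (induction q)
  case 0
  have "{i \<in> {1..d}. \<sigma> i \<le> d} = {}" using rank by force
  then show ?case by (simp add: low_def)
next
  case (Suc q)
  have "1 \<le> inv \<sigma> (Suc (d + q))" using P(2)[of "Suc (d + q)"] Suc.prems by simp
  then show ?case using Suc card_interval_Suc[of q "\<lambda>v. d < inv \<sigma> v"] low_Suc[of "d + q"] by auto
qed

text \<open>Values from \<open>d + 1\<close> on that lie beyond position \<open>d\<close> are
  counted by \<open>x - low (d + x)\<close>, which is monotone in \<open>x\<close>; the form avoids
  subtraction.\<close>

lemma high_mono:
  assumes "x \<le> y" "d + y \<le> n"
  shows "x + low (d + y) \<le> y + low (d + x)"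
proof -
  have "card {v \<in> {Suc d..d + x}. d < inv \<sigma> v} \<le> card {v \<in> {Suc d..d + y}. d < inv \<sigma> v}"
    using assms by (intro card_mono) auto
  then show ?thesis using card_high_plus_low[of x] card_high_plus_low[of y] assms by linarith
qed

text \<open>Minima passed by time \<open>t\<close> are at most \<open>v\<close>. As \<open>v\<close>
  lies beyond position \<open>d\<close>, \<open>not_low_iff\<close> carries this bound over from the
  minima to the entries themselves.\<close>

lemma downs_le_low:
  assumes "d < v" "v \<le> n" "d < inv \<sigma> v" "d + ups t < v"
  shows "downs t \<le> low v"
proof -
  have "{i \<in> {1..d}. prefix_min \<sigma> i \<le> d + ups t + 1} \<subseteq> {i \<in> {1..d}. \<sigma> i \<le> v}"
    using not_low_iff[OF assms(1-3)] assms(4) by fastforce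
  then have "card {i \<in> {1..d}. prefix_min \<sigma> i \<le> d + ups t + 1} \<le> low v"
    unfolding low_def by (intro card_mono) auto
  then show ?thesis using downs_le[of t] by linarith
qed

end

text \<open>With \<open>d\<close> maximal, the square of size \<open>d + 1\<close> does contain a
  point. It is what orders the entries beyond the rank.\<close>

locale max_ranked_132 = ranked_132 +
  assumes maximal: "d < n \<Longrightarrow> \<exists>i. 1 \<le> i \<and> i \<le> Suc d \<and> \<sigma> i \<le> Suc d"
begin

interpretation A: ranked_132 "inv \<sigma>" n d
  by (rule ranked_132_inv)

lemmas inv_inv = permutes_inv_inv[OF p]

abbreviation "high_positions \<equiv> {x \<in> {Suc d..n}. d < \<sigma> x}"
abbreviation "high_values \<equiv> {v \<in> {Suc d..n}. d < inv \<sigma> v}"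

text \<open>A descent among these entries would form 132 with the point of the square of size
  \<open>d + 1\<close>. If that point is itself the left entry, its value is \<open>d + 1\<close>,
  the least one possible.\<close>

lemma strict_mono_on_high: "strict_mono_on high_positions \<sigma>"
  unfolding strict_mono_on_def
proof (intro allI impI, elim conjE)
  fix x y assume xy: "x \<in> high_positions" "y \<in> high_positions" "x < y"
  then obtain i where i: "1 \<le> i" "i \<le> Suc d" "\<sigma> i \<le> Suc d" using maximal by auto
  show "\<sigma> x < \<sigma> y"
  proof (cases "i = x")
    case True
    then show ?thesis using i xy P(5)[of x y] by auto
  next
    case False
    then have "i < x" using i xy by auto
    moreover have "\<sigma> i < \<sigma> y" using i xy P(5)[of i y] \<open>i < x\<close> by auto
    moreover have "\<not> \<sigma> y < \<sigma> x"
      using av xy i(1) calculation unfolding avoids_132_def by (metis (no_types, lifting) atLeastAtMost_iff mem_Collect_eq)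
    ultimately show ?thesis using P(5)[of x y] xy(3) by linarith
  qed
qed

lemma bij_betw_high: "bij_betw \<sigma> high_positions high_values"
proof -
  have "\<sigma> ` high_positions = high_values"
  proof (intro equalityI subsetI)
    fix v assume "v \<in> \<sigma> ` high_positions"
    then obtain x where "x \<in> high_positions" "v = \<sigma> x" by blast
    then show "v \<in> high_values" using P(1)[of x] P(4)[of x] by simp
  next
    fix v assume "v \<in> high_values"
    then have "inv \<sigma> v \<in> high_positions" using P(2)[of v] P(3)[of v] by simp
    then show "v \<in> \<sigma> ` high_positions" using P(3)[of v] image_eqI[of v \<sigma> "inv \<sigma> v"] by simp
  qed
  then show ?thesis using P(5) by (simp add: bij_betw_def inj_on_def)
qed

text \<open>Monotonicity gives \<open>v\<close> the same rank among the high values as its position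
  has among the high positions. Both ranks are then expressed through \<open>low\<close>.\<close>

lemma high_rank:
  assumes "d < v" "v \<le> n" "d < inv \<sigma> v"
  shows "A.low (inv \<sigma> v - 1) + (v - 1 - d - low (v - 1)) = inv \<sigma> v - 1 - d"
    and "low (v - 1) \<le> v - 1 - d" and "inv \<sigma> v \<le> n" and "A.low (inv \<sigma> v) = A.low (inv \<sigma> v - 1)"
proof -
  let ?x = "inv \<sigma> v"
  have x: "?x \<in> high_positions" using assms P(2)[of v] P(3)[of v] by simp
  then show "?x \<le> n" by simp
  have "card {b \<in> high_values. b < \<sigma> ?x} = card {a \<in> high_positions. a < ?x}"
    by (rule card_less_strict_mono_bij[OF bij_betw_high strict_mono_on_high x])
  also have "{b \<in> high_values. b < \<sigma> ?x} = {w \<in> {Suc d..d + (v - 1 - d)}. d < inv \<sigma> w}"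
    using assms P(3)[of v] by auto
  also have "{a \<in> high_positions. a < ?x} = {w \<in> {Suc d..d + (?x - 1 - d)}. d < inv (inv \<sigma>) w}"
    using assms x by (auto simp: inv_inv)
  finally have eq: "card {w \<in> {Suc d..d + (v - 1 - d)}. d < inv \<sigma> w} = card {w \<in> {Suc d..d + (?x - 1 - d)}. d < inv (inv \<sigma>) w}" .
  have c1: "card {w \<in> {Suc d..d + (v - 1 - d)}. d < inv \<sigma> w} + low (v - 1) = v - 1 - d"
    using card_high_plus_low[of "v - 1 - d"] assms by simp
  have c2: "card {w \<in> {Suc d..d + (?x - 1 - d)}. d < inv (inv \<sigma>) w} + A.low (?x - 1) = ?x - 1 - d"
    using A.card_high_plus_low[of "?x - 1 - d"] assms \<open>?x \<le> n\<close> by simp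
  show "low (v - 1) \<le> v - 1 - d" using c1 by linarith
  show "A.low (?x - 1) + (v - 1 - d - low (v - 1)) = ?x - 1 - d" using c1 c2 eq by linarith
  show "A.low ?x = A.low (?x - 1)"
    using A.low_Suc[of "?x - 1"] assms by (simp add: inv_inv P(3))
qed

context
  fixes t :: nat
  assumes t: "t < n" "Suc t \<notin> D"
begin

lemma up_value: "d < Suc (d + ups t)" "Suc (d + ups t) \<le> n"
  using ups_less[OF t] by auto

text \<open>If \<open>v\<close> lies in the first \<open>d\<close> positions, it is an excedance
  value at a step that is no reflection. Otherwise the question is whether the walk of the inverse
  has already reflected at the position of \<open>v\<close>.\<close>

lemma excedance_at_up:
  "inv \<sigma> (Suc (d + ups t)) < Suc (d + ups t) \<longleftrightarrow>
     \<not> (downs t = low (d + ups t) \<and> A.ups t + low (d + ups t) \<le> ups t + A.low (d + A.ups t))" (is ?E)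
  and fixed_point_at_up:
  "\<sigma> (Suc (d + ups t)) = Suc (d + ups t) \<longleftrightarrow>
     Suc t \<notin> A.D \<and> A.downs t = A.low (d + A.ups t) \<and> downs t = low (d + ups t) \<and>
     A.ups t + low (d + ups t) = ups t + A.low (d + A.ups t)" (is ?F)
proof -
  let ?v = "Suc (d + ups t)"
  define x where "x = inv \<sigma> ?v"
  note us = up_step[OF t]
  have "?E \<and> ?F"
  proof (cases "x \<le> d")
    case True
    then have "low (d + ups t) < downs t" using us(2) by (simp add: x_def)
    moreover have "\<sigma> ?v \<noteq> ?v" using True P(4)[of ?v] by (auto simp: x_def)
    ultimately show ?thesis using True by (simp add: x_def)
  next
    case False
    then have dx: "d < inv \<sigma> ?v" by (simp add: x_def)
    note hr = high_rank[OF up_value dx]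
    have down: "downs t = low (d + ups t)" using us(1,2) False by (simp add: x_def)
    \<comment> \<open>The number of reflections so far in the walk of the permutation;
      \<open>v\<close> is thus the high value preceded by exactly \<open>\<rho>\<close> others, and
      \<open>q\<close> below is the number of the up step that stands for its position.\<close>
    define \<rho> where "\<rho> = ups t - low (d + ups t)"
    have rho: "ups t = low (d + ups t) + \<rho>" using hr(2) by (simp add: \<rho>_def)
    define q where "q = x - d"
    have q: "x = d + q" "1 \<le> q" "x \<le> n" using False hr(3) by (auto simp: q_def x_def)
    have lowq: "A.low (d + q) = A.low (d + (q - 1))" "A.low (d + (q - 1)) + \<rho> = q - 1"
      using hr(1,4) q(1,2) unfolding x_def[symmetric] by (simp_all add: \<rho>_def)
    have early: "A.downs s \<le> A.low (d + q)" if "A.ups s < q" for s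
    proof -
      have "d < inv (inv \<sigma>) x" using P(3)[of ?v] by (simp add: inv_inv x_def)
      then show ?thesis using A.downs_le_low[of x s] q that by simp
    qed
    have time: "A.downs t + A.ups t = t" "downs t + ups t = t" by (rule A.downs_ups downs_ups)+
    have alow: "A.low (d + A.ups t) \<le> A.downs t" using A.low_le_downs t by simp
    have un: "d + A.ups t \<le> n" using A.ups_mono[of t n] A.ups_n t dn by simp
    have late: "q + A.low (d + A.ups t) \<le> A.ups t + A.low (d + q)" "A.low (d + q) \<le> A.low (d + A.ups t)"
      if "q \<le> A.ups t"
      using A.high_mono[OF that un] A.low_mono that by auto
    have soon: "A.ups t + A.low (d + (q - 1)) \<le> q - 1 + A.low (d + A.ups t)" if "A.ups t \<le> q - 1"
      using A.high_mono[OF that] q by simp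
    \<comment> \<open>If up step \<open>q\<close> of the inverse has happened, \<open>late\<close>
      bounds \<open>A.low (d + q)\<close> by \<open>A.downs t\<close>; if not, \<open>early\<close>
      gives the opposite bound. As both walks have made \<open>t\<close> steps, either bound settles
      how \<open>q\<close> compares with \<open>ups t\<close>.\<close>
    have E: "q \<le> ups t \<longleftrightarrow> \<rho> + A.low (d + A.ups t) < A.ups t"
    proof (cases "q \<le> A.ups t")
      case True
      then show ?thesis using late lowq rho down time alow q(2) by linarith
    next
      case False
      then show ?thesis using early[of t] soon lowq rho down time q(2) by linarith
    qed
    have "(q = Suc (ups t)) \<longleftrightarrow> Suc t \<notin> A.D \<and> A.downs t = A.low (d + A.ups t) \<and> A.ups t = \<rho> + A.low (d + A.ups t)"
    proof
      assume q': "q = Suc (ups t)"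
      then have less: "A.ups t < q" using late lowq rho down time alow q(2) by linarith
      have 1: "A.ups t = ups t" "A.downs t = downs t"
        using less early[OF less] lowq rho down time q' by linarith+
      then have 2: "A.downs t = A.low (d + A.ups t)" using lowq rho down q' by simp
      \<comment> \<open>A down step of the inverse here would leave up step \<open>q\<close> still
        ahead, so \<open>early\<close> would bound one down step too many.\<close>
      have "Suc t \<notin> A.D"
      proof
        assume "Suc t \<in> A.D"
        then have "A.ups (Suc t) < q" "A.downs (Suc t) = Suc (A.downs t)"
          using less A.ups_Suc[of t] A.downs_Suc[of t] by auto
        then show False using early[of "Suc t"] 2 1 lowq q' by simp
      qed
      then show "Suc t \<notin> A.D \<and> A.downs t = A.low (d + A.ups t) \<and> A.ups t = \<rho> + A.low (d + A.ups t)"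
        using 1 2 rho down by simp
    next
      assume *: "Suc t \<notin> A.D \<and> A.downs t = A.low (d + A.ups t) \<and> A.ups t = \<rho> + A.low (d + A.ups t)"
      then have eq: "A.ups t = ups t" using time rho down by linarith
      have "\<not> inv (inv \<sigma>) (Suc (d + A.ups t)) \<le> d" using A.up_step(2)[OF t(1)] * by simp
      then have al: "A.low (Suc (d + A.ups t)) = A.low (d + A.ups t)"
        using A.up_step(3)[OF t(1)] * by simp
      have "\<not> q \<le> ups t" using E eq * by linarith
      \<comment> \<open>By the reflection of the inverse at this step, position
        \<open>d + ups t + 1\<close> is already the high position with \<open>\<rho>\<close> high
        ones before it, so \<open>x\<close> cannot lie further right.\<close>
      moreover have "\<not> Suc (ups t) < q"
      proof
        assume "Suc (ups t) < q"
        then have "Suc (ups t) + A.low (d + (q - 1)) \<le> q - 1 + A.low (d + Suc (ups t))"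
          using A.high_mono[of "Suc (ups t)" "q - 1"] q by simp
        then show False using al eq * lowq by simp
      qed
      ultimately show "q = Suc (ups t)" by linarith
    qed
    moreover have "\<sigma> ?v = ?v \<longleftrightarrow> q = Suc (ups t)"
    proof -
      have "\<sigma> ?v = ?v \<longleftrightarrow> x = ?v" unfolding x_def using P(3)[of ?v] P(4)[of ?v] by metis
      then show ?thesis using q(1) by simp
    qed
    moreover have "inv \<sigma> ?v < ?v \<longleftrightarrow> q \<le> ups t" using q(1) unfolding x_def[symmetric] by auto
    ultimately show ?thesis using E rho down by auto
  qed
  then show ?E ?F by blast+
qed

end

lemma stats_pair_word:
  "t \<le> n \<Longrightarrow> sexc (pair_word t A.D D) = card {v \<in> {Suc d..d + ups t}. inv \<sigma> v < v} \<and>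
     sfp (pair_word t A.D D) = card {v \<in> {Suc d..d + ups t}. \<sigma> v = v}"
proof (induction t)
  case 0
  then show ?case by (simp add: ups_def)
next
  case (Suc t)
  then have t: "t < n" by simp
  show ?case
  proof (cases "Suc t \<in> D")
    case True
    then show ?thesis using Suc t by (simp add: refl_walk_time_word A.refl_walk_time_word ups_Suc)
  next
    case False
    note at = excedance_at_up[OF t False] fixed_point_at_up[OF t False]
    have "sexc (pair_word (Suc t) A.D D) = of_bool (inv \<sigma> (Suc (d + ups t)) < Suc (d + ups t)) + sexc (pair_word t A.D D)"
      using t False unfolding at by (auto simp: refl_walk_time_word A.refl_walk_time_word)
    moreover have "sfp (pair_word (Suc t) A.D D) = of_bool (\<sigma> (Suc (d + ups t)) = Suc (d + ups t)) + sfp (pair_word t A.D D)"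
      using t False unfolding at by (auto simp: refl_walk_time_word A.refl_walk_time_word)
    ultimately show ?thesis
      using Suc t False card_interval_Suc[of "ups t" "\<lambda>v. inv \<sigma> v < v"] card_interval_Suc[of "ups t" "\<lambda>v. \<sigma> v = v"]
      by (simp add: ups_Suc)
  qed
qed

lemma sexc_pair_word: "sexc (pair_word n A.D D) = exc n \<sigma>"
proof -
  have "sexc (pair_word n A.D D) = card {v \<in> {Suc d..n}. inv \<sigma> v < v}"
    using stats_pair_word[of n] dn by (simp add: ups_n)
  \<comment> \<open>Excedance values exceed \<open>d\<close>: at positions up to \<open>d\<close> by
    the rank, at later ones because they exceed the position.\<close>
  also have "{v \<in> {Suc d..n}. inv \<sigma> v < v} = \<sigma> ` {i \<in> {1..n}. i < \<sigma> i}"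
  proof (intro equalityI subsetI)
    fix v assume "v \<in> {v \<in> {Suc d..n}. inv \<sigma> v < v}"
    then have "inv \<sigma> v \<in> {i \<in> {1..n}. i < \<sigma> i}" using P(2)[of v] P(3)[of v] by simp
    then show "v \<in> \<sigma> ` {i \<in> {1..n}. i < \<sigma> i}" using P(3)[of v] image_eqI[of v \<sigma> "inv \<sigma> v"] by simp
  next
    fix v assume "v \<in> \<sigma> ` {i \<in> {1..n}. i < \<sigma> i}"
    then obtain i where i: "1 \<le> i" "i \<le> n" "i < \<sigma> i" "v = \<sigma> i" by auto
    then have "d < v" using rank[of i] by (cases "i \<le> d") auto
    then show "v \<in> {v \<in> {Suc d..n}. inv \<sigma> v < v}" using i P(1)[of i] P(4)[of i] by simp
  qed
  also have "card \<dots> = exc n \<sigma>"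
    unfolding exc_def by (rule card_image) (use P(5) in \<open>auto simp: inj_on_def\<close>)
  finally show ?thesis .
qed

lemma sfp_pair_word: "sfp (pair_word n A.D D) = fp n \<sigma>"
proof -
  have "{v \<in> {Suc d..n}. \<sigma> v = v} = {i \<in> {1..n}. \<sigma> i = i}"
    using rank by (auto simp: Suc_le_eq) (metis less_irrefl linorder_not_le order_less_trans One_nat_def Suc_le_eq)
  then show ?thesis using stats_pair_word[of n] dn by (simp add: ups_n fp_def)
qed

lemma length_filter_pair_word: "length (filter (\<lambda>x. \<not> snd x) (pair_word t A B)) = card {s \<in> {1..t}. s \<notin> B}"
proof (induction t)
  case (Suc t)
  have "{s \<in> {1..Suc t}. s \<notin> B} = (if Suc t \<notin> B then insert (Suc t) {s \<in> {1..t}. s \<notin> B} else {s \<in> {1..t}. s \<notin> B})"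
    by (auto simp: le_Suc_eq)
  then show ?case using Suc by simp
qed simp

lemma pair_word_correct:
  "refl_walk (map fst (pair_word n (min_times (inv \<sigma>) d) D)) = (0, int n - 2 * int d)"
  "refl_walk (map snd (pair_word n (min_times (inv \<sigma>) d) D)) = (0, int n - 2 * int d)"
  "sfp (pair_word n (min_times (inv \<sigma>) d) D) = fp n \<sigma>"
  "sexc (pair_word n (min_times (inv \<sigma>) d) D) = exc n \<sigma>"
  "length (filter (\<lambda>x. \<not> snd x) (pair_word n (min_times (inv \<sigma>) d) D)) = n - d"
  using refl_walk_time_word_n A.refl_walk_time_word_n sfp_pair_word sexc_pair_word ups_n
  by (simp_all add: length_filter_pair_word ups_def)

end

section \<open>Injectivity of the encoding of 132-avoiders\<close>

lemma rk_properties: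
  shows "rk n \<sigma> \<le> n" "1 \<le> i \<Longrightarrow> i \<le> rk n \<sigma> \<Longrightarrow> rk n \<sigma> < \<sigma> i"
    "rk n \<sigma> < n \<Longrightarrow> \<exists>i. 1 \<le> i \<and> i \<le> Suc (rk n \<sigma>) \<and> \<sigma> i \<le> Suc (rk n \<sigma>)"
proof -
  let ?K = "{k. k \<le> n \<and> (\<forall>i\<in>{1..k}. k < \<sigma> i)}"
  have fin: "finite ?K" by simp
  have "rk n \<sigma> \<in> ?K" unfolding rk_def by (rule Max_in[OF fin]) (auto intro!: exI[of _ 0])
  then show "rk n \<sigma> \<le> n" "1 \<le> i \<Longrightarrow> i \<le> rk n \<sigma> \<Longrightarrow> rk n \<sigma> < \<sigma> i" by auto
  assume "rk n \<sigma> < n"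
  have "k \<le> rk n \<sigma>" if "k \<in> ?K" for k unfolding rk_def by (rule Max_ge[OF fin that])
  from this[of "Suc (rk n \<sigma>)"] have "Suc (rk n \<sigma>) \<notin> ?K" by auto
  then show "\<exists>i. 1 \<le> i \<and> i \<le> Suc (rk n \<sigma>) \<and> \<sigma> i \<le> Suc (rk n \<sigma>)"
    using \<open>rk n \<sigma> < n\<close> by (auto simp: not_less)
qed

lemma rk_eqI:
  assumes "d \<le> n" "\<And>i. 1 \<le> i \<Longrightarrow> i \<le> d \<Longrightarrow> d < \<sigma> i"
    and "d < n \<Longrightarrow> \<exists>i. 1 \<le> i \<and> i \<le> Suc d \<and> \<sigma> i \<le> Suc d"
  shows "rk n \<sigma> = d"
  unfolding rk_def
proof (rule Max_eqI)
  fix k assume k: "k \<in> {k. k \<le> n \<and> (\<forall>i\<in>{1..k}. k < \<sigma> i)}"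
  show "k \<le> d"
  proof (rule ccontr)
    assume "\<not> k \<le> d"
    then obtain i where "1 \<le> i" "i \<le> Suc d" "\<sigma> i \<le> Suc d" using assms(3) k by auto
    moreover from this have "k < \<sigma> i" using k \<open>\<not> k \<le> d\<close> by auto
    ultimately show False using \<open>\<not> k \<le> d\<close> by simp
  qed
qed (use assms in auto)

lemma max_ranked_132_rk:
  assumes "\<sigma> permutes {1..n}" "avoids_132 n \<sigma>"
  shows "max_ranked_132 \<sigma> n (rk n \<sigma>)"
  using assms rk_properties[where n = n and \<sigma> = \<sigma>] by unfold_locales auto

definition word_132 :: "nat \<Rightarrow> (nat \<Rightarrow> nat) \<Rightarrow> (bool \<times> bool) list" where
  "word_132 n \<sigma> = pair_word n (min_times (inv \<sigma>) (rk n \<sigma>)) (min_times \<sigma> (rk n \<sigma>))"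

lemma pair_word_eq_iff: "pair_word n A B = pair_word n A' B' \<longleftrightarrow> (\<forall>t\<in>{1..n}. (t \<in> A \<longleftrightarrow> t \<in> A') \<and> (t \<in> B \<longleftrightarrow> t \<in> B'))"
  by (auto simp: pair_word_def)

text \<open>Both sides say that the first \<open>i\<close> positions and the first \<open>k\<close>
  values have a point in common.\<close>

lemma prefix_min_inv_le_iff:
  assumes p: "\<sigma> permutes {1..n}" and "1 \<le> i" "i \<le> n" "1 \<le> k" "k \<le> n"
  shows "prefix_min (inv \<sigma>) k \<le> i \<longleftrightarrow> prefix_min \<sigma> i \<le> k"
proof -
  note P = permutes_inv_facts[OF p]
  have "(\<exists>v. 1 \<le> v \<and> v \<le> k \<and> inv \<sigma> v \<le> i) \<longleftrightarrow> (\<exists>x. 1 \<le> x \<and> x \<le> i \<and> \<sigma> x \<le> k)"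
  proof (intro iffI; elim exE conjE)
    fix v assume "1 \<le> v" "v \<le> k" "inv \<sigma> v \<le> i"
    then show "\<exists>x. 1 \<le> x \<and> x \<le> i \<and> \<sigma> x \<le> k"
      using P(2)[of v] P(3)[of v] assms by (intro exI[of _ "inv \<sigma> v"]) auto
  next
    fix x assume "1 \<le> x" "x \<le> i" "\<sigma> x \<le> k"
    then show "\<exists>v. 1 \<le> v \<and> v \<le> k \<and> inv \<sigma> v \<le> i"
      using P(1)[of x] P(4)[of x] assms by (intro exI[of _ "\<sigma> x"]) auto
  qed
  then show ?thesis using assms by (simp add: prefix_min_le_iff)
qed

lemma min_times_determine_prefix_min:
  assumes s: "ranked_132 \<sigma> n d" and t: "ranked_132 \<tau> n d"
    and eq: "min_times \<sigma> d = min_times \<tau> d" and i: "1 \<le> i" "i \<le> d"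
  shows "prefix_min \<sigma> i = prefix_min \<tau> i"
proof -
  \<comment> \<open>Subtracting from \<open>n\<close> turns the strictly falling times into a rising
    sequence, which its image determines.\<close>
  have mono: "strict_mono_on {1..d} (\<lambda>i. n - (prefix_min \<rho> i - i))" if "ranked_132 \<rho> n d" for \<rho>
    unfolding strict_mono_on_def
  proof (intro allI impI, elim conjE)
    interpret ranked_132 \<rho> n d by (rule that)
    fix r s :: nat assume rs: "r \<in> {1..d}" "s \<in> {1..d}" "r < s"
    then have "prefix_min \<rho> s - s < prefix_min \<rho> r - r" by (intro min_time_strict) auto
    moreover have "prefix_min \<rho> r \<le> n" using rs dn by (intro prefix_min_le_n) auto
    ultimately show "n - (prefix_min \<rho> r - r) < n - (prefix_min \<rho> s - s)" by arith
  qed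
  have "(\<lambda>i. n - (prefix_min \<sigma> i - i)) ` {1..d} = (\<lambda>i. n - (prefix_min \<tau> i - i)) ` {1..d}"
    using arg_cong[OF eq, of "image (\<lambda>t. n - t)"] by (simp add: min_times_def image_image)
  from strict_mono_on_unique[OF _ mono[OF s] mono[OF t] this, of i]
  have "n - (prefix_min \<sigma> i - i) = n - (prefix_min \<tau> i - i)" using i by simp
  moreover have "i < prefix_min \<sigma> i" "prefix_min \<sigma> i \<le> n"
    using ranked_132.rank_prefix_min[OF s i] ranked_132.prefix_min_le_n[OF s i(1)] ranked_132.dn[OF s] i by auto
  moreover have "i < prefix_min \<tau> i" "prefix_min \<tau> i \<le> n"
    using ranked_132.rank_prefix_min[OF t i] ranked_132.prefix_min_le_n[OF t i(1)] ranked_132.dn[OF t] i by auto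
  ultimately show ?thesis by arith
qed

text \<open>If \<open>\<tau> i\<close> were larger, the value \<open>\<sigma> i\<close> would come
  later in \<open>\<tau>\<close>, and an earlier prefix minimum, \<open>\<tau> i\<close> and this
  value would form 132. So an avoider takes the least value that its minima allow.\<close>

lemma avoids_132_greedy:
  assumes p: "\<sigma> permutes {1..n}" and q: "\<tau> permutes {1..n}" "avoids_132 n \<tau>"
    and i: "1 \<le> i" "i \<le> n" and pm: "prefix_min \<sigma> i = prefix_min \<tau> i"
    and eq: "\<And>j. 1 \<le> j \<Longrightarrow> j < i \<Longrightarrow> \<sigma> j = \<tau> j"
  shows "\<tau> i \<le> \<sigma> i"
proof (rule ccontr)
  note P = permutes_inv_facts[OF p] and Q = permutes_inv_facts[OF q(1)]
  assume "\<not> \<tau> i \<le> \<sigma> i"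
  then have less: "\<sigma> i < \<tau> i" by simp
  define z where "z = inv \<tau> (\<sigma> i)"
  have z: "\<tau> z = \<sigma> i" "1 \<le> z" "z \<le> n" using Q(2)[of "\<sigma> i"] Q(3)[of "\<sigma> i"] P(1)[of i] i by (auto simp: z_def)
  have "\<not> z < i" using eq[of z] P(5)[of z i] z by auto
  moreover have "z \<noteq> i" using z less by auto
  ultimately have zi: "i < z" by simp
  obtain j where j: "1 \<le> j" "j \<le> i" "prefix_min \<tau> i = \<tau> j" using prefix_min_attained[OF i(1)] .
  have "\<tau> j \<le> \<sigma> i" using prefix_min_le[of i i \<sigma>] i pm j by simp
  moreover from this have "j \<noteq> i" using less by auto
  moreover have "\<tau> j \<noteq> \<sigma> i" using Q(5)[of j z] z zi j by auto
  ultimately have "j < i" "\<tau> j < \<tau> z" "\<tau> z < \<tau> i" using j z less by auto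
  then show False using q(2) j(1) zi z(3) unfolding avoids_132_def by blast
qed

lemma avoids_132_determined_by_prefix_min:
  assumes p: "\<sigma> permutes {1..n}" "avoids_132 n \<sigma>" and q: "\<tau> permutes {1..n}" "avoids_132 n \<tau>"
    and pm: "\<And>i. 1 \<le> i \<Longrightarrow> i \<le> n \<Longrightarrow> prefix_min \<sigma> i = prefix_min \<tau> i"
  shows "\<sigma> = \<tau>"
proof -
  have "\<sigma> i = \<tau> i" if "1 \<le> i" "i \<le> n" for i
    using that
  proof (induction i rule: less_induct)
    case (less i)
    then have eq: "\<sigma> j = \<tau> j" if "1 \<le> j" "j < i" for j using that by simp
    show ?case
      using avoids_132_greedy[OF p(1) q less.prems pm[OF less.prems]]
        avoids_132_greedy[OF q(1) p less.prems pm[OF less.prems, symmetric]] eq by fastforce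
  qed
  moreover have "\<sigma> i = \<tau> i" if "i \<notin> {1..n}" for i using that p(1) q(1) by (simp add: permutes_def)
  ultimately show ?thesis by (metis atLeastAtMost_iff ext)
qed

lemma word_132_inj:
  assumes p: "\<sigma> permutes {1..n}" "avoids_132 n \<sigma>" and q: "\<tau> permutes {1..n}" "avoids_132 n \<tau>"
    and eq: "word_132 n \<sigma> = word_132 n \<tau>"
  shows "\<sigma> = \<tau>"
proof -
  define d where "d = rk n \<sigma>"
  interpret s: max_ranked_132 \<sigma> n d unfolding d_def by (rule max_ranked_132_rk[OF p])
  interpret t': max_ranked_132 \<tau> n "rk n \<tau>" by (rule max_ranked_132_rk[OF q])
  have "n - d = n - rk n \<tau>"
    using s.pair_word_correct(5) t'.pair_word_correct(5) eq unfolding word_132_def d_def by metis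
  then have dt: "rk n \<tau> = d" using s.dn t'.dn by simp
  interpret t: max_ranked_132 \<tau> n d using t'.max_ranked_132_axioms unfolding dt .
  have "min_times (inv \<sigma>) d = min_times (inv \<tau>) d" "min_times \<sigma> d = min_times \<tau> d"
    using eq ranked_132.min_times_sub[OF s.ranked_132_inv] ranked_132.min_times_sub[OF t.ranked_132_inv]
      s.min_times_sub t.min_times_sub
    unfolding word_132_def dt d_def[symmetric] pair_word_eq_iff by blast+
  then have low: "prefix_min (inv \<sigma>) i = prefix_min (inv \<tau>) i" "prefix_min \<sigma> i = prefix_min \<tau> i"
    if "1 \<le> i" "i \<le> d" for i
    using min_times_determine_prefix_min[OF s.ranked_132_inv t.ranked_132_inv]
      min_times_determine_prefix_min[OF s.ranked_132_axioms t.ranked_132_axioms] that by blast+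
  have "prefix_min \<sigma> i = prefix_min \<tau> i" if i: "1 \<le> i" "i \<le> n" for i
  proof (cases "i \<le> d")
    case True
    then show ?thesis using low i by simp
  next
    case False
    then have "d < n" using i by simp
    have "prefix_min \<sigma> (Suc d) \<le> Suc d" "prefix_min \<tau> (Suc d) \<le> Suc d"
      using s.maximal[OF \<open>d < n\<close>] t.maximal[OF \<open>d < n\<close>] by (simp_all add: prefix_min_le_iff)
    then have le: "prefix_min \<sigma> i \<le> Suc d" "prefix_min \<tau> i \<le> Suc d"
      using prefix_min_antimono[of "Suc d" i] False by (auto intro: order.trans)
    \<comment> \<open>Beyond \<open>d\<close> the minima lie in \<open>{1..d + 1}\<close>, so
      comparisons with \<open>k\<close> up to \<open>d\<close> determine them; these are read off
      the first \<open>d\<close> minima of the inverse.\<close>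
    have iff: "prefix_min \<sigma> i \<le> k \<longleftrightarrow> prefix_min \<tau> i \<le> k" if "1 \<le> k" "k \<le> d" for k
      using prefix_min_inv_le_iff[OF p(1) i, of k] prefix_min_inv_le_iff[OF q(1) i, of k] low(1)[of k] that s.dn by simp
    have pos: "1 \<le> prefix_min \<sigma> i" "1 \<le> prefix_min \<tau> i"
      using prefix_min_attained[OF i(1), of \<sigma>] prefix_min_attained[OF i(1), of \<tau>]
        permutes_inv_facts(1)[OF p(1)] permutes_inv_facts(1)[OF q(1)] i
      by (metis atLeastAtMost_iff order.trans)+
    show ?thesis
      using iff[of "prefix_min \<sigma> i"] iff[of "prefix_min \<tau> i"] le pos by linarith
  qed
  then show ?thesis by (rule avoids_132_determined_by_prefix_min[OF p q])
qed

text \<open>Each entry is chosen as the least unused value that is at least the prescribed minimum.\<close>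

lemma ex_permutation_with_prefix_min:
  assumes M: "\<And>i. 1 \<le> i \<Longrightarrow> i \<le> n \<Longrightarrow> 1 \<le> M i \<and> M i + i \<le> Suc n"
    and anti: "\<And>i j. 1 \<le> i \<Longrightarrow> i \<le> j \<Longrightarrow> j \<le> n \<Longrightarrow> M j \<le> M i"
  shows "\<exists>\<sigma>. \<sigma> permutes {1..n} \<and> avoids_132 n \<sigma> \<and> (\<forall>i\<in>{1..n}. prefix_min \<sigma> i = M i)"
proof -
  have "\<exists>f. inj_on f {1..m} \<and> f ` {1..m} \<subseteq> {1..n} \<and>
      (\<forall>i\<in>{1..m}. M i \<le> f i \<and> (\<forall>v. M i \<le> v \<and> v < f i \<longrightarrow> v \<in> f ` {1..<i}))" if "m \<le> n" for m
    using that
  proof (induction m)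
    case 0
    then show ?case by auto
  next
    case (Suc m)
    then obtain f where f: "inj_on f {1..m}" "f ` {1..m} \<subseteq> {1..n}"
      "\<And>i. i \<in> {1..m} \<Longrightarrow> M i \<le> f i" "\<And>i v. i \<in> {1..m} \<Longrightarrow> M i \<le> v \<Longrightarrow> v < f i \<Longrightarrow> v \<in> f ` {1..<i}"
      by auto
    define X where "X = {M (Suc m)..n} - f ` {1..m}"
    have "card (f ` {1..m}) \<le> m" using card_image_le[of "{1..m}" f] by simp
    \<comment> \<open>The bound on \<open>M\<close> leaves at least \<open>m + 1\<close> candidates
      for position \<open>m + 1\<close>, of which at most \<open>m\<close> are used.\<close>
    moreover have "m < card {M (Suc m)..n}" using M[of "Suc m"] Suc.prems by (simp add: less_diff_conv)
    ultimately have "\<not> {M (Suc m)..n} \<subseteq> f ` {1..m}"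
      using card_mono[of "f ` {1..m}" "{M (Suc m)..n}"] by auto
    then have "finite X" "X \<noteq> {}" by (auto simp: X_def)
    define w where "w = Min X"
    have w: "w \<in> X" "\<And>v. v \<in> X \<Longrightarrow> w \<le> v"
      unfolding w_def using Min_in[OF \<open>finite X\<close> \<open>X \<noteq> {}\<close>] Min_le[OF \<open>finite X\<close>] by auto
    define g where "g = f(Suc m := w)"
    have gf: "g i = f i" if "i \<le> m" for i using that by (simp add: g_def)
    have im: "g ` {1..<i} = f ` {1..<i}" if "i \<le> Suc m" for i using that by (auto simp: g_def)
    have ins: "{1..Suc m} = insert (Suc m) {1..m}" by auto
    have img: "g ` {1..m} = f ` {1..m}" using gf by (intro image_cong) auto
    have "inj_on g {1..m}" using f(1) by (rule inj_on_cong[THEN iffD1, rotated]) (simp add: gf)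
    then have "inj_on g {1..Suc m}" unfolding ins
      using img w(1) by (simp add: X_def) (simp add: g_def)
    moreover have "g ` {1..Suc m} \<subseteq> {1..n}"
      unfolding ins image_insert img using f(2) w(1) M[of "Suc m"] Suc.prems by (auto simp: X_def g_def)
    moreover have "M i \<le> g i \<and> (\<forall>v. M i \<le> v \<and> v < g i \<longrightarrow> v \<in> g ` {1..<i})" if "i \<in> {1..Suc m}" for i
    proof (cases "i = Suc m")
      case True
      have "v \<in> f ` {1..m}" if "M (Suc m) \<le> v" "v < w" for v
        using w that by (force simp: X_def)
      moreover have "{1..<Suc m} = {1..m}" by auto
      ultimately show ?thesis using w(1) im[of i] True by (simp add: X_def g_def)
    next
      case False
      then have "i \<in> {1..m}" using that by auto
      then show ?thesis using f(3)[of i] f(4)[of i] im[of i] gf[of i] by simp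
    qed
    ultimately show ?case by blast
  qed
  from this[OF order_refl] obtain f where f: "inj_on f {1..n}" "f ` {1..n} \<subseteq> {1..n}"
      "\<And>i. i \<in> {1..n} \<Longrightarrow> M i \<le> f i" "\<And>i v. i \<in> {1..n} \<Longrightarrow> M i \<le> v \<Longrightarrow> v < f i \<Longrightarrow> v \<in> f ` {1..<i}"
    by auto
  define \<sigma> where "\<sigma> i = (if i \<in> {1..n} then f i else i)" for i
  have "bij_betw f {1..n} {1..n}" using f(1,2) by (simp add: bij_betw_def endo_inj_surj)
  then have "bij_betw \<sigma> {1..n} {1..n}" by (rule bij_betw_cong[THEN iffD1, rotated]) (simp add: \<sigma>_def)
  then have p: "\<sigma> permutes {1..n}" by (rule bij_imp_permutes) (auto simp: \<sigma>_def)
  have \<sigma>f: "\<sigma> i = f i" if "1 \<le> i" "i \<le> n" for i using that by (simp add: \<sigma>_def)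
  have "avoids_132 n \<sigma>" unfolding avoids_132_def
  proof (intro allI impI)
    fix x y z :: nat assume *: "1 \<le> x" "x < y" "y < z" "z \<le> n" "\<sigma> x < \<sigma> z" "\<sigma> z < \<sigma> y"
    \<comment> \<open>In a 132 pattern the last value lies between \<open>M y\<close> and
      \<open>\<sigma> y\<close>, so the greedy choice at \<open>y\<close> must have found it already
      used.\<close>
    then have "M y \<le> f z" using anti[of x y] f(3)[of x] \<sigma>f[of x] \<sigma>f[of z] by simp
    then have "f z \<in> f ` {1..<y}" using f(4)[of y "f z"] * \<sigma>f[of y] \<sigma>f[of z] by simp
    then obtain a where "1 \<le> a" "a < y" "f a = f z" by auto
    then show False using inj_onD[OF f(1), of a z] * by auto
  qed
  moreover have "prefix_min \<sigma> i = M i" if i: "i \<in> {1..n}" for i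
  proof (rule antisym)
    obtain x where "1 \<le> x" "x \<le> i" "prefix_min \<sigma> i = \<sigma> x" using prefix_min_attained[of i \<sigma>] i by auto
    then show "M i \<le> prefix_min \<sigma> i" using i anti[of x i] f(3)[of x] \<sigma>f[of x] by simp
    show "prefix_min \<sigma> i \<le> M i"
    proof (cases "f i = M i")
      case True
      then show ?thesis using prefix_min_le[of i i \<sigma>] i \<sigma>f[of i] by simp
    next
      case False
      then have "M i \<in> f ` {1..<i}" using f(3)[OF i] f(4)[OF i, of "M i"] by simp
      then obtain a where "1 \<le> a" "a < i" "f a = M i" by auto
      then show ?thesis using prefix_min_le[of a i \<sigma>] i \<sigma>f[of a] by simp
    qed
  qed
  ultimately show ?thesis using p by blast
qed

section \<open>From pairs of walks back to 132-avoiders\<close>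

lemma refl_walk_time_word_diff:
  "fst (refl_walk (time_word t D)) - snd (refl_walk (time_word t D)) = 2 * int (card {s \<in> {1..t}. s \<in> D}) - int t"
proof (induction t)
  case (Suc t)
  have "{s \<in> {1..Suc t}. s \<in> D} = (if Suc t \<in> D then insert (Suc t) {s \<in> {1..t}. s \<in> D} else {s \<in> {1..t}. s \<in> D})"
    by (auto simp: le_Suc_eq)
  moreover obtain b r where "refl_walk (time_word t D) = (b, r)" by force
  ultimately show ?case using Suc by auto
qed simp

text \<open>A reflection never loses height, so the net gain after time \<open>t\<close> bounds the
  final height from below. With final height 0 this is the ballot condition: after any time there
  are at most as many down steps as up steps.\<close>

lemma refl_walk_time_word_growth:
  assumes "t \<le> n"
  shows "2 * int (card {s \<in> {Suc t..n}. s \<in> D}) - (int n - int t) \<le> fst (refl_walk (time_word n D))"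
  using assms
proof (induction n rule: dec_induct)
  case base
  obtain b r where "refl_walk (time_word t D) = (b, r)" by force
  then show ?case using refl_walk_invar by fastforce
next
  case (step n)
  have "{s \<in> {Suc t..Suc n}. s \<in> D} = (if Suc n \<in> D then insert (Suc n) {s \<in> {Suc t..n}. s \<in> D} else {s \<in> {Suc t..n}. s \<in> D})"
    using step(1) by (auto simp: le_Suc_eq)
  moreover obtain b r where "refl_walk (time_word n D) = (b, r)" by force
  ultimately show ?case using step by auto
qed

text \<open>With \<open>e\<close> the increasing enumeration of \<open>B\<close>, times falling in
  \<open>i\<close> force \<open>M i - i = e (d + 1 - i)\<close>. Then \<open>d < M i\<close> follows
  from \<open>j \<le> e j\<close>, and the upper bound is the ballot condition just before time
  \<open>e j\<close>.\<close>

lemma ex_prefix_min_of_ballot: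
  assumes B: "B \<subseteq> {1..n}" "card B = d" and w: "fst (refl_walk (time_word n B)) = 0"
  shows "\<exists>M. (\<forall>i\<in>{1..d}. d < M i \<and> M i + i \<le> Suc n) \<and> (\<forall>i\<in>{1..d}. \<forall>j\<in>{1..d}. i \<le> j \<longrightarrow> M j \<le> M i) \<and>
    (\<lambda>i. M i - i) ` {1..d} = B"
proof -
  have fin: "finite B" using B(1) finite_subset by blast
  obtain e where e: "bij_betw e {1..d} B" "strict_mono_on {1..d} e"
    by (rule ex_strict_mono_bij_betw[of "{1..d}" B]) (use fin B in auto)
  have eB: "e j \<in> B" if "1 \<le> j" "j \<le> d" for j using e(1) that by (auto simp: bij_betw_def)
  have gap: "e a + (b - a) \<le> e b" if "1 \<le> a" "a \<le> b" "b \<le> d" for a b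
    using that(2,3)
  proof (induction b rule: dec_induct)
    case (step b)
    have "e b < e (Suc b)" using e(2) step \<open>1 \<le> a\<close> by (auto simp: strict_mono_on_def)
    then show ?case using step by simp
  qed simp
  have ge: "j \<le> e j" if "1 \<le> j" "j \<le> d" for j
    using gap[of 1 j] eB[of 1] B(1) that by fastforce
  have top: "2 * (Suc d - j) + e j \<le> Suc n" if "1 \<le> j" "j \<le> d" for j
  proof -
    have ej: "1 \<le> e j" "e j \<le> n" using eB[OF that] B(1) by auto
    have "card {b \<in> B. b < e j} = card {a \<in> {1..d}. a < j}"
      by (rule card_less_strict_mono_bij[OF e]) (use that in auto)
    also have "{a \<in> {1..d}. a < j} = {1..<j}" using that by auto
    finally have 1: "card {b \<in> B. b < e j} = j - 1" by simp
    have "B = {b \<in> B. b < e j} \<union> {s \<in> {Suc (e j - 1)..n}. s \<in> B}" using B(1) ej by auto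
    moreover have "card ({b \<in> B. b < e j} \<union> {s \<in> {Suc (e j - 1)..n}. s \<in> B})
        = card {b \<in> B. b < e j} + card {s \<in> {Suc (e j - 1)..n}. s \<in> B}"
      using fin ej by (intro card_Un_disjoint) auto
    ultimately have "d = j - 1 + card {s \<in> {Suc (e j - 1)..n}. s \<in> B}" using B(2) 1 by simp
    moreover have "e j - 1 \<le> n" using ej by simp
    note refl_walk_time_word_growth[OF this, of B, unfolded w]
    ultimately show ?thesis using ej that by linarith
  qed
  define M where "M i = e (Suc d - i) + i" for i
  have "d < M i \<and> M i + i \<le> Suc n" if "i \<in> {1..d}" for i
  proof -
    define j where "j = Suc d - i"
    have j: "1 \<le> j" "j \<le> d" "i + j = Suc d" using that by (auto simp: j_def)
    show ?thesis using ge[OF j(1,2)] top[OF j(1,2)] j(3) unfolding M_def j_def[symmetric] by linarith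
  qed
  moreover have "M j \<le> M i" if "i \<in> {1..d}" "j \<in> {1..d}" "i \<le> j" for i j
  proof -
    have "e (Suc d - j) + (Suc d - i - (Suc d - j)) \<le> e (Suc d - i)" using that by (intro gap) auto
    moreover have "Suc d - i - (Suc d - j) + i = j" using that by auto
    ultimately show ?thesis unfolding M_def by linarith
  qed
  moreover have "(\<lambda>i. M i - i) ` {1..d} = B"
  proof -
    have "(\<lambda>i. M i - i) ` {1..d} = e ` ((\<lambda>i. Suc d - i) ` {1..d})" by (simp add: M_def image_image)
    also have "(\<lambda>i. Suc d - i) ` {1..d} = {1..d}"
    proof (intro equalityI subsetI)
      fix i assume "i \<in> {1..d}"
      then show "i \<in> (\<lambda>i. Suc d - i) ` {1..d}" by (intro image_eqI[of _ _ "Suc d - i"]) auto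
    qed auto
    finally show ?thesis using e(1) by (simp add: bij_betw_def)
  qed
  ultimately show ?thesis by blast
qed

lemma downward_closed_eq_interval:
  fixes S :: "nat set"
  assumes sub: "S \<subseteq> {1..d}" and down: "\<And>i j. j \<in> S \<Longrightarrow> 1 \<le> i \<Longrightarrow> i \<le> j \<Longrightarrow> i \<in> S"
  shows "S = {1..card S}"
proof (cases "S = {}")
  case False
  have fin: "finite S" using sub finite_subset by blast
  define m where "m = Max S"
  have m: "m \<in> S" "\<And>i. i \<in> S \<Longrightarrow> i \<le> m" unfolding m_def using Max_in[OF fin False] Max_ge[OF fin] by auto
  have "S = {1..m}" using m(2) sub down[OF m(1)] by auto
  then show ?thesis by simp
qed simp

lemma word_132_surj:
  assumes len: "length xs = n"
    and walk: "refl_walk (map fst xs) = (0, r)" "refl_walk (map snd xs) = (0, r)"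
  shows "\<exists>\<sigma>. \<sigma> permutes {1..n} \<and> avoids_132 n \<sigma> \<and> word_132 n \<sigma> = xs"
proof -
  define A where "A = {t \<in> {1..n}. fst (xs ! (n - t))}"
  define B where "B = {t \<in> {1..n}. snd (xs ! (n - t))}"
  have xs: "pair_word n A B = xs"
  proof (rule nth_equalityI)
    fix s assume "s < length (pair_word n A B)"
    then have "s < n" by simp
    then have "rev [1..<Suc n] ! s = n - s" by (simp add: rev_nth del: upt_Suc)
    then show "pair_word n A B ! s = xs ! s"
      using \<open>s < n\<close> by (simp add: pair_word_def A_def B_def prod_eq_iff Suc_le_eq del: upt_Suc)
  qed (simp add: len)
  have walks: "refl_walk (time_word n A) = (0, r)" "refl_walk (time_word n B) = (0, r)"
    using walk unfolding xs[symmetric] by simp_all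
  have sub: "A \<subseteq> {1..n}" "B \<subseteq> {1..n}" by (auto simp: A_def B_def)
  define d where "d = card B"
  have int: "{s \<in> {1..n}. s \<in> A} = A" "{s \<in> {1..n}. s \<in> B} = B" using sub by auto
  have cA: "card A = d" and "int d \<le> int n"
    using refl_walk_time_word_diff[of n A] refl_walk_time_word_diff[of n B] walks
      refl_walk_invar[OF walks(1)] unfolding int d_def by auto
  then have dn: "d \<le> n" by simp
  have w0: "fst (refl_walk (time_word n A)) = 0" "fst (refl_walk (time_word n B)) = 0"
    by (simp_all add: walks)
  obtain N where N': "\<forall>i\<in>{1..d}. d < N i \<and> N i + i \<le> Suc n"
      "\<forall>i\<in>{1..d}. \<forall>j\<in>{1..d}. i \<le> j \<longrightarrow> N j \<le> N i" and N3: "(\<lambda>i. N i - i) ` {1..d} = B"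
    using ex_prefix_min_of_ballot[OF sub(2) d_def[symmetric] w0(2)] by blast
  have N: "d < N i \<and> N i + i \<le> Suc n" if "1 \<le> i" "i \<le> d" for i
    using N'(1) that by simp
  have N_anti: "N j \<le> N i" if "1 \<le> i" "i \<le> j" "j \<le> d" for i j
    using N'(2) that by simp
  obtain G where G': "\<forall>i\<in>{1..d}. d < G i \<and> G i + i \<le> Suc n"
      "\<forall>i\<in>{1..d}. \<forall>j\<in>{1..d}. i \<le> j \<longrightarrow> G j \<le> G i" and G3: "(\<lambda>i. G i - i) ` {1..d} = A"
    using ex_prefix_min_of_ballot[OF sub(1) cA w0(1)] by blast
  have G: "d < G i \<and> G i + i \<le> Suc n" if "1 \<le> i" "i \<le> d" for i
    using G'(1) that by simp
  have G_anti: "G j \<le> G i" if "1 \<le> i" "i \<le> j" "j \<le> d" for i j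
    using G'(2) that by simp
  define S where "S i = {k \<in> {1..d}. i < G k}" for i
  have S: "S i = {1..card (S i)}" for i
    by (rule downward_closed_eq_interval[of _ d]) (use G_anti in \<open>fastforce simp: S_def\<close>)+
  have Sd: "card (S i) \<le> d" for i 
  proof -
    have "card (S i) \<le> card {1..d}" by (intro card_mono) (auto simp: S_def)
    then show ?thesis by simp
  qed
  have S_iff: "k \<le> card (S i) \<longleftrightarrow> i < G k" if "1 \<le> k" "k \<le> d" for i k
  proof -
    have "k \<le> card (S i) \<longleftrightarrow> k \<in> S i" using S[of i] that(1) by (metis atLeastAtMost_iff)
    then show ?thesis using that by (simp add: S_def)
  qed
  \<comment> \<open>For \<open>i > d\<close> the minimum must be at most \<open>k\<close> iff
    \<open>G k \<le> i\<close>, for each \<open>k\<close> up to \<open>d\<close>. Hence it is one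
    more than the number of \<open>k\<close> with \<open>i < G k\<close>.\<close>
  define M where "M i = (if i \<le> d then N i else Suc (card (S i)))" for i
  have M1: "1 \<le> M i \<and> M i + i \<le> Suc n" if "1 \<le> i" "i \<le> n" for i
  proof (cases "i \<le> d \<or> card (S i) = 0")
    case True
    then show ?thesis using N[of i] that by (auto simp: M_def)
  next
    case False
    then have "i < G (card (S i))" using S_iff[of "card (S i)" i] Sd[of i] by simp
    then show ?thesis using False G[of "card (S i)"] Sd[of i] by (simp add: M_def)
  qed
  have M2: "M j \<le> M i" if "1 \<le> i" "i \<le> j" "j \<le> n" for i j
  proof -
    consider "j \<le> d" | "i \<le> d" "d < j" | "d < i" by linarith
    then show ?thesis
    proof cases
      case 1 then show ?thesis using N_anti[of i j] that by (simp add: M_def)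
    next
      case 2 then show ?thesis using N[of i] Sd[of j] that by (simp add: M_def)
    next
      case 3
      have "card (S j) \<le> card (S i)" using that by (intro card_mono) (auto simp: S_def)
      then show ?thesis using 3 that by (simp add: M_def)
    qed
  qed
  obtain \<sigma> where p: "\<sigma> permutes {1..n}" and av: "avoids_132 n \<sigma>"
      and pm: "\<And>i. 1 \<le> i \<Longrightarrow> i \<le> n \<Longrightarrow> prefix_min \<sigma> i = M i"
    using ex_permutation_with_prefix_min[of n M, OF M1 M2] by auto
  have rk: "rk n \<sigma> = d"
  proof (rule rk_eqI[OF dn])
    show "d < \<sigma> i" if "1 \<le> i" "i \<le> d" for i
      using N[OF that] pm[of i] prefix_min_le[of i i \<sigma>] that dn by (simp add: M_def)
    show "\<exists>i. 1 \<le> i \<and> i \<le> Suc d \<and> \<sigma> i \<le> Suc d" if "d < n"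
      using pm[of "Suc d"] Sd[of "Suc d"] that prefix_min_le_iff[of "Suc d" \<sigma> "Suc d"] by (simp add: M_def)
  qed
  have pG: "prefix_min (inv \<sigma>) k = G k" if k: "1 \<le> k" "k \<le> d" for k
  proof -
    note P = permutes_inv_facts[OF p]
    have le: "prefix_min (inv \<sigma>) k \<le> i \<longleftrightarrow> G k \<le> i" if i: "1 \<le> i" "i \<le> n" for i
    proof -
      have "prefix_min (inv \<sigma>) k \<le> i \<longleftrightarrow> M i \<le> k"
        using prefix_min_inv_le_iff[OF p i, of k] pm[OF i] k dn by simp
      also have "\<dots> \<longleftrightarrow> G k \<le> i"
      proof (cases "i \<le> d")
        case True
        then show ?thesis using N[of i] G[OF k] i k by (simp add: M_def)
      next
        case False
        then show ?thesis using S_iff[OF k, of i] by (auto simp: M_def)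
      qed
      finally show ?thesis .
    qed
    obtain x where "1 \<le> x" "x \<le> k" "prefix_min (inv \<sigma>) k = inv \<sigma> x" using prefix_min_attained[OF k(1)] .
    then have "1 \<le> prefix_min (inv \<sigma>) k" "prefix_min (inv \<sigma>) k \<le> n" using P(2)[of x] k dn by auto
    then show ?thesis
      using le[of "prefix_min (inv \<sigma>) k"] le[of "G k"] G[OF k] k by (intro antisym) auto
  qed
  have "min_times \<sigma> d = B"
    unfolding min_times_def N3[symmetric] using pm dn by (intro image_cong) (auto simp: M_def)
  moreover have "min_times (inv \<sigma>) d = A"
    unfolding min_times_def G3[symmetric] using pG by (intro image_cong) auto
  ultimately have "word_132 n \<sigma> = xs" by (simp add: word_132_def rk xs)
  then show ?thesis using p av by blast
qed

lemma bij_betw_word_132: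
  "bij_betw (word_132 n)
     {\<sigma>. \<sigma> permutes {1..n} \<and> avoids_132 n \<sigma> \<and> fp n \<sigma> = i \<and> exc n \<sigma> = j \<and> n - rk n \<sigma> = k}
     {xs. length xs = n \<and> (\<exists>r. refl_walk (map fst xs) = (0, r) \<and> refl_walk (map snd xs) = (0, r)) \<and>
          sfp xs = i \<and> sexc xs = j \<and> length (filter (\<lambda>x. \<not> snd x) xs) = k}"
  (is "bij_betw _ ?S ?W")
  unfolding bij_betw_def
proof (intro conjI inj_onI equalityI subsetI)
  fix \<sigma> \<tau> assume "\<sigma> \<in> ?S" "\<tau> \<in> ?S" "word_132 n \<sigma> = word_132 n \<tau>"
  then show "\<sigma> = \<tau>" using word_132_inj by blast
next
  fix xs assume "xs \<in> word_132 n ` ?S"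
  then obtain \<sigma> where s: "\<sigma> \<in> ?S" "xs = word_132 n \<sigma>" by blast
  then have "max_ranked_132 \<sigma> n (rk n \<sigma>)" by (simp add: max_ranked_132_rk)
  note this[THEN max_ranked_132.pair_word_correct(1)] this[THEN max_ranked_132.pair_word_correct(2)]
    this[THEN max_ranked_132.pair_word_correct(3)] this[THEN max_ranked_132.pair_word_correct(4)]
    this[THEN max_ranked_132.pair_word_correct(5)]
  then show "xs \<in> ?W" using s unfolding word_132_def by simp
next
  fix xs assume xs: "xs \<in> ?W"
  then obtain \<sigma> where s: "\<sigma> permutes {1..n}" "avoids_132 n \<sigma>" "word_132 n \<sigma> = xs"
    using word_132_surj by blast
  then have "max_ranked_132 \<sigma> n (rk n \<sigma>)" by (simp add: max_ranked_132_rk)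
  note this[THEN max_ranked_132.pair_word_correct(3)] this[THEN max_ranked_132.pair_word_correct(4)]
    this[THEN max_ranked_132.pair_word_correct(5)]
  then have "\<sigma> \<in> ?S" using s xs unfolding word_132_def by simp
  then show "xs \<in> word_132 n ` ?S" using s(3) by blast
qed

theorem theorem2:
  fixes n i j k :: nat
  assumes "n \<ge> 1" and "i \<le> n" and "j \<le> n" and "k \<le> n"
  shows "card {\<sigma> \<in> avoiders n [3, 2, 1]. fp n \<sigma> = i \<and> exc n \<sigma> = j \<and> lis n \<sigma> = k}
       = card {\<sigma> \<in> avoiders n [1, 3, 2]. fp n \<sigma> = i \<and> exc n \<sigma> = j \<and> rk n \<sigma> = n - k}"
proof -
  have "{\<sigma> \<in> avoiders n [3, 2, 1]. fp n \<sigma> = i \<and> exc n \<sigma> = j \<and> lis n \<sigma> = k} =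
      {\<sigma>. \<sigma> permutes {1..n} \<and> avoids_321 n \<sigma> \<and> fp n \<sigma> = i \<and> exc n \<sigma> = j \<and> lis n \<sigma> = k}"
    unfolding avoiders_321 by auto
  \<comment> \<open>Subtraction is truncated; the bounds by \<open>n\<close> on both the rank and
    \<open>k\<close> make the two forms equivalent.\<close>
  moreover have "rk n \<sigma> = n - k \<longleftrightarrow> n - rk n \<sigma> = k" for \<sigma>
    using rk_properties(1)[of n \<sigma>] \<open>k \<le> n\<close> by linarith
  then have "{\<sigma> \<in> avoiders n [1, 3, 2]. fp n \<sigma> = i \<and> exc n \<sigma> = j \<and> rk n \<sigma> = n - k} =
      {\<sigma>. \<sigma> permutes {1..n} \<and> avoids_132 n \<sigma> \<and> fp n \<sigma> = i \<and> exc n \<sigma> = j \<and> n - rk n \<sigma> = k}"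
    unfolding avoiders_132 by auto
  ultimately show ?thesis
    by (simp only: bij_betw_same_card[OF bij_betw_word_321] bij_betw_same_card[OF bij_betw_word_132]
      bij_betw_same_card[OF bij_betw_transfer])
qed

end
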